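(* Let $d\ge1$ and let $L$ be a (homogeneous) Poisson point process on $\mathbb{R}^d$ of intensity $\lambda\in(0,\infty)$. With probability $1$, friendly frogs on $L$ is a win for Bob.
   Context: Distances are Euclidean. The realization of the Poisson process is regarded as a random (countable) set $L$ of points. Friendly frogs on a set $L\subset\mathbb{R}^d$ is the following two-player game. First Alice chooses a point of $L$ and places a frog on it. Then Bob places a second frog on a different point of $L$. Then the players alternately move, starting with Alice. A move consists of moving either one of the two frogs (both players may move either frog) to another point of $L$, in such a way that the distance between the two frogs is strictly decreased and the two frogs do not occupy the same point. A player who cannot move loses, and the other player wins. A strategy for a player assigns a legal move (if one exists) to each position; a winning strategy is one that results in a win for that player whatever strategy the other player uses. The game is a win for a player if that player has a winning strategy. The players know the realization of $L$. *)

theory Defs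
  imports "HOL-Probability.Probability"
begin

text \<open>
  The point process is given by the random set \<open>L \<omega>\<close>. Local finiteness is part of the
  definition because \<open>card\<close> is 0 on infinite sets. The Poisson probabilities are written out so
  that Lebesgue-null sets \<open>B\<close> are covered as well (then the count is almost surely 0).
\<close>

locale homogeneous_poisson_process = prob_space M
  for M :: "'w measure"
    and L :: "'w \<Rightarrow> 'a::euclidean_space set"
    and intensity :: real +
  assumes locally_finite:
      "AE \<omega> in M. \<forall>B. bounded B \<longrightarrow> finite (L \<omega> \<inter> B)"
    and count_measurable:
      "\<And>B. B \<in> sets borel \<Longrightarrow> bounded B \<Longrightarrow>
        random_variable (count_space UNIV) (\<lambda>\<omega>. card (L \<omega> \<inter> B))"
    and count_poisson:
      "\<And>B k. B \<in> sets borel \<Longrightarrow> bounded B \<Longrightarrow>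
        prob {\<omega> \<in> space M. card (L \<omega> \<inter> B) = k} =
          (intensity * measure lborel B) ^ k / fact k * exp (- (intensity * measure lborel B))"
    and count_indep:
      "\<And>(B :: nat \<Rightarrow> 'a set) I. finite I \<Longrightarrow> disjoint_family_on B I \<Longrightarrow>
        (\<And>i. i \<in> I \<Longrightarrow> B i \<in> sets borel \<and> bounded (B i)) \<Longrightarrow>
        indep_vars (\<lambda>_. count_space UNIV) (\<lambda>i \<omega>. card (L \<omega> \<inter> B i)) I"

datatype player = Alice | Bob

datatype 'a position = NoFrogs | OneFrog 'a | TwoFrogs 'a 'a

inductive legal_move :: "'a::metric_space set \<Rightarrow> 'a position \<Rightarrow> 'a position \<Rightarrow> bool"
  for L :: "'a set" where
  place_first: "x \<in> L \<Longrightarrow> legal_move L NoFrogs (OneFrog x)"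
| place_second: "y \<in> L \<Longrightarrow> y \<noteq> x \<Longrightarrow> legal_move L (OneFrog x) (TwoFrogs x y)"
| move_first: "x' \<in> L \<Longrightarrow> x' \<noteq> x \<Longrightarrow> x' \<noteq> y \<Longrightarrow> dist x' y < dist x y \<Longrightarrow>
    legal_move L (TwoFrogs x y) (TwoFrogs x' y)"
| move_second: "y' \<in> L \<Longrightarrow> y' \<noteq> y \<Longrightarrow> y' \<noteq> x \<Longrightarrow> dist x y' < dist x y \<Longrightarrow>
    legal_move L (TwoFrogs x y) (TwoFrogs x y')"

definition stuck :: "'a::metric_space set \<Rightarrow> 'a position \<Rightarrow> bool" where
  "stuck L p \<longleftrightarrow> (\<nexists>q. legal_move L p q)"

text \<open>
  A strategy is consulted only when its owner is to move, so the position need not record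
  whose turn it is.
\<close>

definition strategy :: "'a::metric_space set \<Rightarrow> ('a position \<Rightarrow> 'a position) \<Rightarrow> bool" where
  "strategy L s \<longleftrightarrow> (\<forall>p. \<not> stuck L p \<longrightarrow> legal_move L p (s p))"

text \<open>
  Turns are numbered from 0, placements included: Alice places (turn 0), Bob places (turn 1),
  Alice moves (turn 2), and so on.
\<close>

definition mover :: "nat \<Rightarrow> player" where
  "mover n = (if even n then Alice else Bob)"

primrec play :: "(player \<Rightarrow> 'a position \<Rightarrow> 'a position) \<Rightarrow> nat \<Rightarrow> 'a position" where
  "play \<sigma> 0 = NoFrogs"
| "play \<sigma> (Suc n) = \<sigma> (mover n) (play \<sigma> n)"

text \<open>
  The game ends at the first stuck position; later values of \<open>play\<close> are irrelevant.
  An infinite play is a win for neither player.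
\<close>

definition wins_play ::
  "'a::metric_space set \<Rightarrow> (player \<Rightarrow> 'a position \<Rightarrow> 'a position) \<Rightarrow> player \<Rightarrow> bool" where
  "wins_play L \<sigma> P \<longleftrightarrow>
    (\<exists>n. stuck L (play \<sigma> n) \<and> (\<forall>m<n. \<not> stuck L (play \<sigma> m)) \<and> mover n \<noteq> P)"

definition winning_strategy ::
  "'a::metric_space set \<Rightarrow> player \<Rightarrow> ('a position \<Rightarrow> 'a position) \<Rightarrow> bool" where
  "winning_strategy L P s \<longleftrightarrow>
    strategy L s \<and> (\<forall>\<sigma>. (\<forall>Q. strategy L (\<sigma> Q)) \<and> \<sigma> P = s \<longrightarrow> wins_play L \<sigma> P)"

definition friendly_frogs_win :: "'a::metric_space set \<Rightarrow> player \<Rightarrow> bool" where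
  "friendly_frogs_win L P \<longleftrightarrow> (\<exists>s. winning_strategy L P s)"

end

theory Submission
  imports Defs "HOL-Real_Asymp.Real_Asymp" "HOL-Library.Transitive_Closure_Table"
begin

text \<open>
  Call two points partners if the player to move from the position they form loses. Bob wins by
  always restoring a pair of partners, provided that every point has a partner and that no play is
  infinite.

  An infinite play has decreasing frog distances, eventually in an interval \<open>[a, b]\<close> around their
  limit so short that the expected number of points in the corresponding shell is below 1. The
  graph joining points at such distances then almost surely has bounded components only, but an
  infinite play visits infinitely many points of one component.

  Since terminating games are determined, two points without a partner within distance \<open>R\<close> are more
  than \<open>R\<close> apart. Hence among \<open>J\<close> disjoint translates of a cube at most one contains a point
  without a partner nearby. By translation invariance these events are equally likely, so each has
  probability at most \<open>1 / J\<close>. The law of the process is accessible only through counts, so the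
  game is compared with the games on the occupied corners of finer and finer grids; the outcomes
  agree in the limit because almost surely no three points form an isosceles triangle.
\<close>

section \<open>Winning and terminating positions\<close>

text \<open>Measurability is assumed only of counts in bounded Borel sets, and no measurability of
  losing pairs or of points without a partner is at hand. Every almost sure claim is therefore
  reduced to events about occupied grid cells, in one of two ways. Isosceles triangles and unbounded
  components are handled by first moments: such a configuration leaves, on every fine grid, a set of
  distinct occupied cells with slightly relaxed distances, and the expected number of such sets is
  bounded by volumes. The outcome of the game is instead stable under rounding. Termination and
  local finiteness make it depend on finitely many comparisons of distances, and no comparison is a
  tie between different points. The bound \<open>1 / J\<close> rests on two facts about the
  translated events: they overlap in null sets, and they have equal probability because the law of
  the occupied cells is an explicit formula in which only the intensity enters.\<close>

inductive losing :: "'a::metric_space set \<Rightarrow> 'a position \<Rightarrow> bool" for L where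
  losingI: "(\<And>q. legal_move L p q \<Longrightarrow> \<exists>r. legal_move L q r \<and> losing L r) \<Longrightarrow> losing L p"

lemma losing_iff:
  "losing L p \<longleftrightarrow> (\<forall>q. legal_move L p q \<longrightarrow> (\<exists>r. legal_move L q r \<and> losing L r))"
  by (subst losing.simps) auto

lemma losingD:
  "losing L p \<Longrightarrow> legal_move L p q \<Longrightarrow> \<exists>r. legal_move L q r \<and> losing L r"
  using losing_iff by blast

abbreviation terminating :: "'a::metric_space set \<Rightarrow> 'a position \<Rightarrow> bool" where
  "terminating L \<equiv> Wellfounded.accp (\<lambda>q p. legal_move L p q)"

text \<open>
  Termination is a separate hypothesis: in a position with cycles, replies that keep the opponent
  in a losing position need not make progress.
\<close>

lemma friendly_frogs_win_Bob:
  assumes "losing L NoFrogs" and "terminating L NoFrogs"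
  shows "friendly_frogs_win L Bob"
proof -
  \<comment> \<open>A strategy must be legal wherever a move exists, so \<open>s\<close> falls back
    on an arbitrary legal move at positions without a losing successor.\<close>
  define s where "s p = (if \<exists>q. legal_move L p q \<and> losing L q
      then SOME q. legal_move L p q \<and> losing L q else SOME q. legal_move L p q)" for p
  have s_losing: "legal_move L p (s p) \<and> losing L (s p)" if "legal_move L p q" "losing L q" for p q
  proof -
    have ex: "\<exists>q. legal_move L p q \<and> losing L q" using that by blast
    show ?thesis using someI_ex[OF ex] ex by (simp add: s_def)
  qed
  have strat: "strategy L s"
    unfolding strategy_def stuck_def
  proof (intro allI impI)
    fix p assume "\<not> (\<nexists>q. legal_move L p q)"
    then have ex: "\<exists>q. legal_move L p q" by blast
    show "legal_move L p (s p)"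
    proof (cases "\<exists>q. legal_move L p q \<and> losing L q")
      case True
      then show ?thesis using s_losing by blast
    next
      case False
      show ?thesis unfolding s_def if_not_P[OF False] by (rule someI_ex[OF ex])
    qed
  qed
  have wins: "wins_play L \<sigma> Bob"
    if \<sigma>: "\<forall>Q. strategy L (\<sigma> Q)" "\<sigma> Bob = s" for \<sigma>
  proof -
    have move: "legal_move L (play \<sigma> n) (play \<sigma> (Suc n))" if "\<not> stuck L (play \<sigma> n)" for n
      using that \<sigma>(1) by (auto simp: strategy_def)
    have inv: "losing L (play \<sigma> n)" if "even n" "\<forall>m<n. \<not> stuck L (play \<sigma> m)" for n
      using that
    proof (induction n rule: less_induct)
      case (less n)
      show ?case
      proof (cases "n = 0")
        case True
        then show ?thesis using assms(1) by simp
      next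
        case False
        then obtain j where j: "n = Suc j" by (cases n) auto
        with less.prems(1) obtain k where "j = Suc k" by (cases j) auto
        with j less.prems(1) have n: "n = Suc (Suc k)" "even k" by auto
        have "losing L (play \<sigma> k)" using less n by simp
        moreover have "legal_move L (play \<sigma> k) (play \<sigma> (Suc k))"
          using move less.prems n by simp
        ultimately obtain r where "legal_move L (play \<sigma> (Suc k)) r" "losing L r"
          using losingD by blast
        from s_losing[OF this] show ?thesis using n \<sigma>(2) by (simp add: mover_def)
      qed
    qed
    have "wins_play L \<sigma> Bob"
      if "terminating L p" "play \<sigma> n = p" "\<forall>m<n. \<not> stuck L (play \<sigma> m)" for p n
      using that
    proof (induction p arbitrary: n rule: accp.induct)
      case (accI p)
      note play_n = accI.prems(1) and not_stuck = accI.prems(2)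
      show ?case
      proof (cases "stuck L p")
        case True
        \<comment> \<open>If Bob were to move, the position would be a successor of a losing one,
          and such a position has a reply.\<close>
        have "even n"
        proof (rule ccontr)
          assume "odd n"
          then obtain k where n: "n = Suc k" "even k" by (cases n) auto
          have "losing L (play \<sigma> k)" using inv n not_stuck by simp
          moreover have "legal_move L (play \<sigma> k) p" using move[of k] n play_n not_stuck by simp
          ultimately show False using True losingD unfolding stuck_def by blast
        qed
        then show ?thesis
          unfolding wins_play_def using play_n not_stuck True
          by (intro exI[of _ n]) (simp add: mover_def)
      next
        case False
        have "legal_move L p (play \<sigma> (Suc n))" using move[of n] False play_n by simp
        moreover have "\<forall>m<Suc n. \<not> stuck L (play \<sigma> m)"
          using not_stuck play_n False by (auto simp: less_Suc_eq)
        ultimately show ?thesis using accI.IH by blast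
      qed
    qed
    from this[OF assms(2), of 0] show ?thesis by simp
  qed
  show ?thesis
    unfolding friendly_frogs_win_def winning_strategy_def using strat wins by blast
qed

text \<open>Determinacy: a position that is not losing has a successor without losing reply, and by
  the induction hypothesis that successor is itself losing.\<close>

lemma losing_or_move_to_losing:
  assumes "terminating L p"
  shows "losing L p \<or> (\<exists>q. legal_move L p q \<and> losing L q)"
  using assms
proof (induction p rule: accp.induct)
  case (accI p)
  show ?case
  proof (cases "losing L p")
    case False
    then obtain q where q: "legal_move L p q" "\<nexists>r. legal_move L q r \<and> losing L r"
      using losing_iff[of L p] by blast
    then show ?thesis using accI.IH[OF q(1)] by blast
  qed blast
qed

section \<open>Symmetries of the game\<close>

text \<open>\<open>losing\<close> alternates universal and existential moves, so
  \<open>\<phi>\<close> has to preserve moves and also to lift them back.\<close>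

lemma losing_simulation:
  assumes "losing L p"
    and move: "\<And>p q. legal_move L p q \<Longrightarrow> legal_move L' (\<phi> p) (\<phi> q)"
    and move': "\<And>p q'. legal_move L' (\<phi> p) q' \<Longrightarrow> \<exists>q. q' = \<phi> q \<and> legal_move L p q"
  shows "losing L' (\<phi> p)"
  using assms(1)
proof (induction p rule: losing.induct)
  case (losingI p)
  show ?case
  proof (rule losing.losingI)
    fix q' assume "legal_move L' (\<phi> p) q'"
    then show "\<exists>r. legal_move L' q' r \<and> losing L' r" using move move' losingI by metis
  qed
qed

inductive_cases legal_move_NoFrogsE: "legal_move L NoFrogs q"
inductive_cases legal_move_OneFrogE: "legal_move L (OneFrog x) q"
inductive_cases legal_move_TwoFrogsE: "legal_move L (TwoFrogs x y) q"

text \<open>The game treats the frogs alike while \<open>TwoFrogs\<close> is ordered; this makes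
  being partners a symmetric relation.\<close>

lemma losing_swap:
  assumes "losing L (TwoFrogs x y)"
  shows "losing L (TwoFrogs y x)"
proof -
  have "losing L p \<Longrightarrow> p = TwoFrogs x y \<Longrightarrow> losing L (TwoFrogs y x)" for p x y
  proof (induction p arbitrary: x y rule: losing.induct)
    case (losingI p)
    have swap: "legal_move L (TwoFrogs y x) (TwoFrogs w z)" 
      if "legal_move L (TwoFrogs x y) (TwoFrogs z w)" for x y z w
      using that by cases (auto intro!: legal_move.intros simp: dist_commute)
    have two: "\<exists>z w. q = TwoFrogs z w" if "legal_move L (TwoFrogs x y) q" for x y q
      using that by cases auto
    show ?case
    proof (rule losing.losingI)
      fix q assume q: "legal_move L (TwoFrogs y x) q"
      then obtain z w where zw: "q = TwoFrogs z w" using two by blast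
      have "legal_move L p (TwoFrogs w z)" using swap q zw losingI.prems by blast
      then obtain r where r: "legal_move L (TwoFrogs w z) r" 
        "\<forall>x y. r = TwoFrogs x y \<longrightarrow> losing L (TwoFrogs y x)"
        using losingI.IH by blast
      then obtain u v where "r = TwoFrogs u v" using two by blast
      then show "\<exists>r. legal_move L q r \<and> losing L r" using r swap zw by blast
    qed
  qed
  then show ?thesis using assms by blast
qed

lemma losing_isometry:
  assumes "losing L p" and T: "\<And>x y. dist (T x) (T y) = dist x y"
  shows "losing (T ` L) (map_position T p)"
  using assms(1)
proof (rule losing_simulation)
  have inj: "T x = T y \<longleftrightarrow> x = y" for x y by (metis T dist_eq_0_iff)
  show "legal_move (T ` L) (map_position T p) (map_position T q)" if "legal_move L p q" for p q
    using that by cases (auto simp: T inj intro!: legal_move.intros)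
  show "\<exists>q. q' = map_position T q \<and> legal_move L p q" if "legal_move (T ` L) (map_position T p) q'" for p q'
  proof (cases p)
    case NoFrogs
    then have "legal_move (T ` L) NoFrogs q'" using that by simp
    then obtain x where "x \<in> L" "q' = OneFrog (T x)" by (auto elim: legal_move_NoFrogsE)
    then show ?thesis
      using NoFrogs by (intro exI[of _ "OneFrog x"]) (auto intro: legal_move.intros)
  next
    case (OneFrog x)
    then have "legal_move (T ` L) (OneFrog (T x)) q'" using that by simp
    then obtain y where "y \<in> L" "y \<noteq> x" "q' = TwoFrogs (T x) (T y)"
      by (auto elim: legal_move_OneFrogE)
    then show ?thesis
      using OneFrog by (intro exI[of _ "TwoFrogs x y"]) (auto intro: legal_move.intros)
  next
    case (TwoFrogs x y)
    have "legal_move (T ` L) (TwoFrogs (T x) (T y)) q'" using that TwoFrogs by simp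
    then show ?thesis
    proof (rule legal_move_TwoFrogsE)
      fix u assume u: "q' = TwoFrogs u (T y)" "u \<in> T ` L" "u \<noteq> T x" "u \<noteq> T y"
        "dist u (T y) < dist (T x) (T y)"
      then obtain z where "z \<in> L" "u = T z" by auto
      then show ?thesis
        using TwoFrogs u by (intro exI[of _ "TwoFrogs z y"]) (auto simp: T intro: legal_move.intros)
    next
      fix u assume u: "q' = TwoFrogs (T x) u" "u \<in> T ` L" "u \<noteq> T y" "u \<noteq> T x"
        "dist (T x) u < dist (T x) (T y)"
      then obtain z where "z \<in> L" "u = T z" by auto
      then show ?thesis
        using TwoFrogs u by (intro exI[of _ "TwoFrogs x z"]) (auto simp: T intro: legal_move.intros)
    qed
  qed
qed

text \<open>\<open>y\<close> is the frog that stays and \<open>x\<close> the one that moves; the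
  strict inequality already excludes \<open>z = x\<close>.\<close>

definition closer :: "'a::metric_space set \<Rightarrow> 'a \<Rightarrow> 'a \<Rightarrow> 'a set" where
  "closer L y x = {z \<in> L. z \<noteq> y \<and> dist z y < dist x y}"

lemma legal_moves_TwoFrogs:
  "{q. legal_move L (TwoFrogs x y) q} =
    (\<lambda>z. TwoFrogs z y) ` closer L y x \<union> (\<lambda>z. TwoFrogs x z) ` closer L x y"
  unfolding closer_def
  by (auto elim!: legal_move_TwoFrogsE intro!: legal_move.intros simp: dist_commute)

text \<open>A winning move leaves one frog in place, and the losing pair it creates gives that frog
  a partner at less than the old distance.\<close>

lemma closer_partner:
  assumes "terminating L (TwoFrogs x y)"
  shows "losing L (TwoFrogs x y) \<or> (\<exists>z\<in>closer L x y. losing L (TwoFrogs x z)) \<or>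
    (\<exists>z\<in>closer L y x. losing L (TwoFrogs y z))"
proof -
  from losing_or_move_to_losing[OF assms] show ?thesis
  proof (elim disjE exE conjE)
    fix q assume q: "legal_move L (TwoFrogs x y) q" "losing L q"
    then consider z where "q = TwoFrogs z y" "z \<in> closer L y x" | z where "q = TwoFrogs x z" "z \<in> closer L x y"
      using legal_moves_TwoFrogs[of L x y] by blast
    then show ?thesis using q(2) losing_swap by cases blast+
  qed blast
qed

lemma losing_NoFrogs:
  assumes "\<And>x. x \<in> L \<Longrightarrow> \<exists>y\<in>L. y \<noteq> x \<and> losing L (TwoFrogs x y)"
  shows "losing L NoFrogs"
  by (rule losingI) (metis assms legal_move_NoFrogsE legal_move.place_second)

lemma terminating_NoFrogs:
  assumes "\<And>x y. x \<in> L \<Longrightarrow> y \<in> L \<Longrightarrow> x \<noteq> y \<Longrightarrow> terminating L (TwoFrogs x y)"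
  shows "terminating L NoFrogs"
proof (rule accpI)
  fix q assume "legal_move L NoFrogs q"
  then obtain x where x: "x \<in> L" "q = OneFrog x" by (auto elim: legal_move_NoFrogsE)
  show "terminating L q"
    unfolding x(2) by (rule accpI) (use x assms in \<open>auto elim!: legal_move_OneFrogE\<close>)
qed

section \<open>Comparing the game with games on nearby point sets\<close>

text \<open>A legal move compares two distances from the frog that stays, so ties matter only
  between distances from a common point.\<close>

definition isosceles_free :: "'a::metric_space set \<Rightarrow> bool" where
  "isosceles_free L \<longleftrightarrow> (\<forall>x\<in>L. \<forall>y\<in>L. \<forall>z\<in>L. dist x y = dist x z \<longrightarrow> y = z)"

text \<open>Closeness is uniform so that the possibly infinitely many distant points cannot be
  mapped into the range of a move.\<close>

locale approximation_scheme =
  fixes f :: "nat \<Rightarrow> 'a::metric_space \<Rightarrow> 'a" and W :: "nat \<Rightarrow> 'a set"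
  assumes f_close: "\<And>e. e > 0 \<Longrightarrow> \<forall>\<^sub>F N in sequentially. \<forall>x. dist (f N x) x < e"
    and W_exhausts: "\<And>x. \<forall>\<^sub>F N in sequentially. x \<in> W N"
begin

definition approx :: "'a set \<Rightarrow> nat \<Rightarrow> 'a set" where
  "approx L N = f N ` (L \<inter> W N)"

lemma f_tendsto: "(\<lambda>N. f N x) \<longlonglongrightarrow> x"
  unfolding tendsto_iff using f_close by (fast elim: eventually_mono)

text \<open>Rounding could break a tie either way. Without ties, each comparison within a finite set
  keeps its outcome once displacements are small.\<close>

lemma eventually_closer:
  assumes fin: "\<forall>B. bounded B \<longrightarrow> finite (L \<inter> B)"
    and iso: "isosceles_free L"
    and x: "x \<in> L" and y: "y \<in> L"
  shows "\<forall>\<^sub>F N in sequentially. closer (approx L N) (f N y) (f N x) = f N ` closer L y x"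
proof -
  \<comment> \<open>The margin 1 pays for four displacements of less than 1/4, so a point whose
    image is in range of a move already lies in \<open>F\<close>.\<close>
  define F where "F = L \<inter> cball y (dist x y + 1)"
  have finF: "finite F" unfolding F_def using fin by simp
  have lim: "(\<lambda>N. dist (f N u) (f N v)) \<longlonglongrightarrow> dist u v" for u v
    by (intro tendsto_dist f_tendsto)
  have "\<forall>\<^sub>F N in sequentially. z \<in> W N \<and> (z \<noteq> y \<longrightarrow> f N z \<noteq> f N y) \<and>
      (dist (f N z) (f N y) < dist (f N x) (f N y) \<longleftrightarrow> dist z y < dist x y)" if "z \<in> F" for z
  proof (intro eventually_conj W_exhausts)
    show "\<forall>\<^sub>F N in sequentially. z \<noteq> y \<longrightarrow> f N z \<noteq> f N y"
    proof (cases "z = y")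
      case False
      then have "\<forall>\<^sub>F N in sequentially. 0 < dist (f N z) (f N y)"
        using order_tendstoD(1)[OF lim[of z y], of 0] by simp
      then show ?thesis by (rule eventually_mono) auto
    qed simp
    show "\<forall>\<^sub>F N in sequentially.
        dist (f N z) (f N y) < dist (f N x) (f N y) \<longleftrightarrow> dist z y < dist x y"
    proof (cases "z = x")
      case False
      then have "dist z y \<noteq> dist x y" using iso x y that
        unfolding isosceles_free_def by (metis F_def IntD1 dist_commute)
      then consider "dist z y < dist x y" | "dist z y > dist x y" by linarith
      then show ?thesis
      proof cases
        case 1
        then have "\<forall>\<^sub>F N in sequentially. 0 < dist (f N x) (f N y) - dist (f N z) (f N y)"
          by (intro order_tendstoD(1)[OF tendsto_diff[OF lim lim]]) simp
        then show ?thesis using 1 by (auto elim: eventually_mono)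
      next
        case 2
        then have "\<forall>\<^sub>F N in sequentially. 0 < dist (f N z) (f N y) - dist (f N x) (f N y)"
          by (intro order_tendstoD(1)[OF tendsto_diff[OF lim lim]]) simp
        then show ?thesis using 2 by (auto elim: eventually_mono)
      qed
    qed simp
  qed
  then have "\<forall>\<^sub>F N in sequentially. \<forall>z\<in>F. z \<in> W N \<and> (z \<noteq> y \<longrightarrow> f N z \<noteq> f N y) \<and>
      (dist (f N z) (f N y) < dist (f N x) (f N y) \<longleftrightarrow> dist z y < dist x y)"
    using finF by (simp add: eventually_ball_finite_distrib)
  moreover have "\<forall>\<^sub>F N in sequentially. \<forall>x. dist (f N x) x < 1/4"
    by (rule f_close) simp
  ultimately show ?thesis
  proof eventually_elim
    case (elim N)
    have F_iff: "z \<in> W N" "z \<noteq> y \<Longrightarrow> f N z \<noteq> f N y"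
        "dist (f N z) (f N y) < dist (f N x) (f N y) \<longleftrightarrow> dist z y < dist x y" if "z \<in> F" for z
      using elim(1) that by auto
    have inF: "z \<in> F" if "z \<in> L" "dist (f N z) (f N y) < dist (f N x) (f N y)" for z
    proof -
      have "dist (f N z) z < 1/4" "dist (f N x) x < 1/4" "dist (f N y) y < 1/4" using elim(2) by auto
      then have "dist z y \<le> dist x y + 1" 
        using that(2) dist_triangle[of z y "f N z"] dist_triangle[of "f N z" y "f N y"]
          dist_triangle[of "f N x" "f N y" x] dist_triangle[of x "f N y" y]
        by (simp add: dist_commute)
      then show ?thesis using that(1) by (simp add: F_def dist_commute)
    qed
    show ?case
    proof (intro equalityI subsetI)
      fix g assume g: "g \<in> closer (approx L N) (f N y) (f N x)"
      then obtain z where z: "z \<in> L" "g = f N z" by (auto simp: closer_def approx_def)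
      then have "z \<in> F" using g inF by (simp add: closer_def)
      then show "g \<in> f N ` closer L y x" using F_iff[of z] z g by (auto simp: closer_def)
    next
      fix g assume "g \<in> f N ` closer L y x"
      then obtain z where z: "z \<in> closer L y x" "g = f N z" by auto
      then have "z \<in> F" by (auto simp: closer_def F_def dist_commute)
      then show "g \<in> closer (approx L N) (f N y) (f N x)"
        using F_iff[of z] z by (auto simp: closer_def approx_def)
    qed
  qed
qed

lemma eventually_losing:
  assumes fin: "\<forall>B. bounded B \<longrightarrow> finite (L \<inter> B)"
    and iso: "isosceles_free L"
    and "terminating L (TwoFrogs x y)" "x \<in> L" "y \<in> L"
  shows "\<forall>\<^sub>F N in sequentially.
    losing (approx L N) (TwoFrogs (f N x) (f N y)) \<longleftrightarrow> losing L (TwoFrogs x y)"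
proof -
  let ?M = "\<lambda>p. {q. legal_move L p q}"
  let ?MN = "\<lambda>N p. {q. legal_move (approx L N) p q}"
  define good where "good p \<longleftrightarrow> (\<exists>x y. p = TwoFrogs x y \<and> x \<in> L \<and> y \<in> L)" for p
  have good_move: "good q" if "good p" "legal_move L p q" for p q
    using that unfolding good_def by (auto elim!: legal_move_TwoFrogsE)
  have moves: "\<forall>\<^sub>F N in sequentially. ?MN N (map_position (f N) p) = map_position (f N) ` ?M p"
    if gp: "good p" for p
  proof -
    obtain x y where p: "p = TwoFrogs x y" "x \<in> L" "y \<in> L" using gp by (auto simp: good_def)
    from eventually_closer[OF fin iso p(2,3)] eventually_closer[OF fin iso p(3,2)]
    show ?thesis
    proof eventually_elim
      case (elim N)
      then show ?case by (simp add: p(1) legal_moves_TwoFrogs image_Un image_image)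
    qed
  qed
  have fin_moves: "finite (?M p)" if gp: "good p" for p
  proof -
    obtain x y where p: "p = TwoFrogs x y" "x \<in> L" "y \<in> L" using gp by (auto simp: good_def)
    have "finite (closer L u v)" for u v
      by (rule finite_subset[of _ "L \<inter> cball u (dist v u)"])
        (use fin in \<open>auto simp: closer_def dist_commute\<close>)
    then show ?thesis by (simp add: p(1) legal_moves_TwoFrogs)
  qed
  define E where "E p \<longleftrightarrow>
    (\<forall>\<^sub>F N in sequentially. losing (approx L N) (map_position (f N) p) \<longleftrightarrow> losing L p)" for p
  \<comment> \<open>\<open>losing\<close> unfolds to replies two moves ahead, while the induction
    hypothesis concerns direct successors; the claim therefore includes the successors of
    \<open>p\<close>.\<close>
  have "good p \<Longrightarrow> E p \<and> (\<forall>q\<in>?M p. E q)" if "terminating L p" for p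
    using that
  proof (induction p rule: accp.induct)
    case (accI p)
    have step: "\<forall>\<^sub>F N in sequentially.
        ?MN N (map_position (f N) q) = map_position (f N) ` ?M q \<and>
        (\<forall>r\<in>?M q. losing (approx L N) (map_position (f N) r) \<longleftrightarrow> losing L r)"
      if q: "q \<in> ?M p" for q
    proof (intro eventually_conj moves)
      show gq: "good q" using q good_move accI.prems by auto
      have "\<forall>\<^sub>F N in sequentially. losing (approx L N) (map_position (f N) r) \<longleftrightarrow> losing L r" 
        if "r \<in> ?M q" for r
        using accI.IH[OF _ gq] q that unfolding E_def by blast
      then show "\<forall>\<^sub>F N in sequentially. \<forall>r\<in>?M q.
          losing (approx L N) (map_position (f N) r) \<longleftrightarrow> losing L r"
        using fin_moves[OF gq] by (subst eventually_ball_finite_distrib) blast+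
    qed
    have "\<forall>\<^sub>F N in sequentially. \<forall>q\<in>?M p.
        ?MN N (map_position (f N) q) = map_position (f N) ` ?M q \<and>
        (\<forall>r\<in>?M q. losing (approx L N) (map_position (f N) r) \<longleftrightarrow> losing L r)"
      using fin_moves[OF accI.prems] step by (subst eventually_ball_finite_distrib) blast+
    with moves[OF accI.prems] have "E p"
      unfolding E_def
    proof eventually_elim
      case (elim N)
      have succ: "(\<exists>r\<in>?MN N (map_position (f N) q). losing (approx L N) r) \<longleftrightarrow> (\<exists>r\<in>?M q. losing L r)"
        if "q \<in> ?M p" for q
      proof -
        have moves_q: "?MN N (map_position (f N) q) = map_position (f N) ` ?M q"
          and "\<forall>r\<in>?M q. losing (approx L N) (map_position (f N) r) \<longleftrightarrow> losing L r"
          using elim(2) that by blast+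
        then show ?thesis unfolding moves_q by blast
      qed
      have "losing (approx L N) (map_position (f N) p) \<longleftrightarrow>
          (\<forall>q\<in>?MN N (map_position (f N) p). \<exists>r\<in>?MN N q. losing (approx L N) r)"
        by (subst losing_iff) blast
      also have "\<dots> \<longleftrightarrow> (\<forall>q\<in>?M p. \<exists>r\<in>?M q. losing L r)"
        unfolding elim(1) using succ by blast
      also have "\<dots> \<longleftrightarrow> losing L p"
        by (subst (2) losing_iff) blast
      finally show ?case .
    qed
    then show ?case using accI.IH good_move[OF accI.prems] by blast
  qed
  from this[OF assms(3)] show ?thesis using assms(4,5) by (simp add: good_def E_def)
qed

end

section \<open>Grids and volumes\<close>

text \<open>Rounding down with a mesh that is the reciprocal of an integer, so integer points lie on
  every grid; \<open>grid 0\<close> is the integer lattice.\<close>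

definition grid_point :: "nat \<Rightarrow> 'a::euclidean_space \<Rightarrow> 'a" where
  "grid_point N x = (\<Sum>b\<in>Basis. (of_int \<lfloor>(real N + 1) * (x \<bullet> b)\<rfloor> / (real N + 1)) *\<^sub>R b)"

abbreviation grid :: "nat \<Rightarrow> 'a::euclidean_space set" where
  "grid N \<equiv> range (grid_point N)"

definition cell :: "nat \<Rightarrow> 'a::euclidean_space \<Rightarrow> 'a set" where
  "cell N g = grid_point N -` {g}"

text \<open>Half-open with integer corners, hence a union of cells of every grid; translates of
  \<open>cube 1\<close> by distinct multiples of 2 along a basis vector are disjoint.\<close>

definition cube :: "nat \<Rightarrow> 'a::euclidean_space set" where
  "cube m = {x. \<forall>b\<in>Basis. - real m \<le> x \<bullet> b \<and> x \<bullet> b < real m}"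

lemma grid_point_inner:
  "b \<in> Basis \<Longrightarrow> grid_point N x \<bullet> b = of_int \<lfloor>(real N + 1) * (x \<bullet> b)\<rfloor> / (real N + 1)"
  by (simp add: grid_point_def)

lemma grid_point_bounds:
  assumes "b \<in> Basis"
  shows "grid_point N x \<bullet> b \<le> x \<bullet> b" "x \<bullet> b < grid_point N x \<bullet> b + 1 / (real N + 1)"
proof -
  have "of_int \<lfloor>(real N + 1) * (x \<bullet> b)\<rfloor> \<le> (real N + 1) * (x \<bullet> b)"
    "(real N + 1) * (x \<bullet> b) < of_int \<lfloor>(real N + 1) * (x \<bullet> b)\<rfloor> + 1" by linarith+
  then show "grid_point N x \<bullet> b \<le> x \<bullet> b" "x \<bullet> b < grid_point N x \<bullet> b + 1 / (real N + 1)"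
    using assms by (simp_all add: grid_point_inner field_simps)
qed

lemma dist_grid_point: "dist (grid_point N x) (x::'a::euclidean_space) \<le> DIM('a) / (real N + 1)"
proof -
  have "norm (grid_point N x - x) \<le> (\<Sum>b\<in>Basis. \<bar>(grid_point N x - x) \<bullet> b\<bar>)"
    by (rule norm_le_l1)
  also have "\<dots> \<le> (\<Sum>b\<in>(Basis::'a set). 1 / (real N + 1))"
  proof (rule sum_mono)
    fix b :: 'a assume "b \<in> Basis"
    from grid_point_bounds[OF this, where N=N and x=x]
    show "\<bar>(grid_point N x - x) \<bullet> b\<bar> \<le> 1 / (real N + 1)" by (simp add: inner_diff_left)
  qed
  finally show ?thesis by (simp add: dist_norm)
qed

lemma eventually_mesh_less:
  assumes "e > 0"
  shows "\<forall>\<^sub>F N in sequentially. DIM('a::euclidean_space) / (real N + 1) < e"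
proof -
  have "(\<lambda>N. DIM('a) / (real N + 1)) \<longlonglongrightarrow> 0" by real_asymp
  then show ?thesis using assms by (rule order_tendstoD)
qed

lemma mem_cell: "x \<in> cell N g \<longleftrightarrow> grid_point N x = g"
  by (simp add: cell_def)

lemma cell_eq:
  assumes "g \<in> grid N"
  shows "cell N g = {x. \<forall>b\<in>Basis. g \<bullet> b \<le> x \<bullet> b \<and> x \<bullet> b < g \<bullet> b + 1 / (real N + 1)}"
proof (intro equalityI subsetI)
  fix x assume "x \<in> cell N g"
  then show "x \<in> {x. \<forall>b\<in>Basis. g \<bullet> b \<le> x \<bullet> b \<and> x \<bullet> b < g \<bullet> b + 1 / (real N + 1)}"
    using grid_point_bounds[where N=N and x=x] by (auto simp: mem_cell)
next
  fix x assume x: "x \<in> {x. \<forall>b\<in>Basis. g \<bullet> b \<le> x \<bullet> b \<and> x \<bullet> b < g \<bullet> b + 1 / (real N + 1)}"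
  obtain y where y: "g = grid_point N y" using assms by auto
  have "grid_point N x \<bullet> b = g \<bullet> b" if b: "b \<in> Basis" for b
  proof -
    define k where "k = \<lfloor>(real N + 1) * (y \<bullet> b)\<rfloor>"
    have g: "g \<bullet> b = of_int k / (real N + 1)" using b by (simp add: y grid_point_inner k_def)
    have xb: "g \<bullet> b \<le> x \<bullet> b" "x \<bullet> b < g \<bullet> b + 1 / (real N + 1)" using x b by auto
    have "of_int k \<le> (real N + 1) * (x \<bullet> b)" "(real N + 1) * (x \<bullet> b) < of_int k + 1"
      using xb unfolding g by (simp_all add: field_simps)
    then have "\<lfloor>(real N + 1) * (x \<bullet> b)\<rfloor> = k" by (rule floor_unique)
    then show ?thesis using b g by (simp add: grid_point_inner)
  qed
  then show "x \<in> cell N g" unfolding mem_cell by (rule euclidean_eqI) auto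
qed

text \<open>\<open>m\<close> is a multiple of the mesh, and rounding down to multiples of the mesh
  respects comparisons with such multiples.\<close>

lemma grid_point_mem_cube [simp]: "grid_point N x \<in> cube m \<longleftrightarrow> x \<in> cube m"
proof -
  have "- real m \<le> grid_point N x \<bullet> b \<longleftrightarrow> - real m \<le> x \<bullet> b"
    "grid_point N x \<bullet> b < real m \<longleftrightarrow> x \<bullet> b < real m" if b: "b \<in> Basis" for b
  proof -
    have eq: "(- real m \<le> grid_point N x \<bullet> b) = (of_int (- int m * (int N + 1)) \<le> real_of_int \<lfloor>(real N + 1) * (x \<bullet> b)\<rfloor>)"
      "(grid_point N x \<bullet> b < real m) = (real_of_int \<lfloor>(real N + 1) * (x \<bullet> b)\<rfloor> < of_int (int m * (int N + 1)))"
      using b by (simp_all add: grid_point_inner field_simps)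
    show "- real m \<le> grid_point N x \<bullet> b \<longleftrightarrow> - real m \<le> x \<bullet> b"
      using mult_le_cancel_left_pos[of "real N + 1" "- real m" "x \<bullet> b"]
      unfolding eq of_int_le_iff le_floor_iff by (simp add: mult.commute)
    show "grid_point N x \<bullet> b < real m \<longleftrightarrow> x \<bullet> b < real m"
      using mult_less_cancel_left_pos[of "real N + 1" "x \<bullet> b" "real m"]
      unfolding eq of_int_less_iff floor_less_iff by (simp add: mult.commute)
  qed
  then show ?thesis by (simp add: cube_def)
qed

lemma bounded_cube: "bounded (cube m :: 'a::euclidean_space set)"
  by (rule bounded_subset[of "cbox (- real m *\<^sub>R One) (real m *\<^sub>R One)"])
    (auto simp: cube_def mem_box less_imp_le)

lemma borel_halfopen_box:
  "{x::'a::euclidean_space. \<forall>b\<in>Basis. l b \<le> x \<bullet> b \<and> x \<bullet> b < u b} \<in> sets borel"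
  by measurable

lemma cube_borel [measurable]: "cube m \<in> sets borel"
  unfolding cube_def by (rule borel_halfopen_box)

lemma cell_borel [measurable]:
  assumes "g \<in> grid N" shows "cell N g \<in> sets borel"
  unfolding cell_eq[OF assms] by (rule borel_halfopen_box)

lemma bounded_cell: "bounded (cell N g)"
proof (rule bounded_subset[of "cball g (DIM('a) / (real N + 1))"])
  show "cell N g \<subseteq> cball g (DIM('a) / (real N + 1))" for g :: 'a
    using dist_grid_point[where N=N] by (auto simp: mem_cell)
qed simp

lemma measure_cell:
  assumes "g \<in> grid N"
  shows "measure lborel (cell N (g::'a::euclidean_space)) = (1 / (real N + 1)) ^ DIM('a)"
proof -
  define h where "h = 1 / (real N + 1)"
  let ?u = "g + h *\<^sub>R One"
  have h: "h > 0" by (simp add: h_def)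
  have le: "g \<bullet> b \<le> ?u \<bullet> b" if "b \<in> Basis" for b using that h by (simp add: inner_add_left)
  have val: "measure lborel (box g ?u) = h ^ DIM('a)" "measure lborel (cbox g ?u) = h ^ DIM('a)"
    using le by (simp_all add: inner_diff_left inner_add_left)
  have "measure lborel (box g ?u) \<le> measure lborel (cell N g)"
  proof (rule measure_mono_fmeasurable)
    show "box g ?u \<subseteq> cell N g"
      unfolding cell_eq[OF assms] by (auto simp: mem_box inner_add_left h_def less_imp_le)
    show "cell N g \<in> fmeasurable lborel"
      using assms by (intro bounded_set_imp_lmeasurable fmeasurableI emeasure_bounded_finite bounded_cell) auto
  qed auto
  moreover have "measure lborel (cell N g) \<le> measure lborel (cbox g ?u)"
  proof (rule measure_mono_fmeasurable)
    show "cell N g \<subseteq> cbox g ?u"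
      unfolding cell_eq[OF assms] by (auto simp: mem_box inner_add_left h_def less_imp_le)
  qed (use assms in auto)
  ultimately show ?thesis using val by (simp add: h_def)
qed

text \<open>Packing: the cells are disjoint, of equal volume, and inside \<open>B\<close>. The bound
  for finite subsets also rules out an infinite \<open>A\<close>.\<close>

lemma card_grid_le:
  fixes B :: "'a::euclidean_space set"
  assumes "A \<subseteq> grid N" and "\<And>g. g \<in> A \<Longrightarrow> cell N g \<subseteq> B" and "B \<in> sets borel" "bounded B"
  shows "finite A" "card A * (1 / (real N + 1)) ^ DIM('a) \<le> measure lborel B"
proof -
  define v where "v = (1 / (real N + 1)) ^ DIM('a)"
  have v: "v > 0" by (simp add: v_def)
  have B: "B \<in> fmeasurable lborel"
    using assms(3,4) by (intro fmeasurableI emeasure_bounded_finite) auto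
  have fin: "card F * v \<le> measure lborel B" if "F \<subseteq> A" "finite F" for F
  proof -
    have cellM: "cell N g \<in> sets borel" if "g \<in> F" for g
      using that \<open>F \<subseteq> A\<close> assms(1) by (intro cell_borel) auto
    have cellF: "cell N g \<in> fmeasurable lborel" if "g \<in> F" for g
      using that \<open>F \<subseteq> A\<close> assms(1) by (intro fmeasurableI emeasure_bounded_finite bounded_cell) auto
    have "measure lborel (\<Union>g\<in>F. cell N g) = (\<Sum>g\<in>F. measure lborel (cell N g))"
      using that(2) cellF by (intro measure_UNION') (auto simp: pairwise_def disjnt_def mem_cell)
    also have "\<dots> = card F * v"
      using that assms(1) by (simp add: measure_cell v_def subset_iff)
    finally have eq: "measure lborel (\<Union>g\<in>F. cell N g) = card F * v" .
    have "measure lborel (\<Union>g\<in>F. cell N g) \<le> measure lborel B"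
      using cellM B that assms(2) by (intro measure_mono_fmeasurable) (auto intro!: sets.finite_UN)
    then show ?thesis unfolding eq .
  qed
  show "finite A"
  proof (rule ccontr)
    assume "infinite A"
    then obtain F where F: "F \<subseteq> A" "finite F" "card F = nat \<lceil>measure lborel B / v\<rceil> + 1"
      using infinite_arbitrarily_large by blast
    have "card F > measure lborel B / v" unfolding F(3) by linarith
    then have "card F * v > measure lborel B" using v by (simp add: field_simps)
    then show False using fin[OF F(1,2)] by simp
  qed
  from fin[OF subset_refl this] show "card A * (1 / (real N + 1)) ^ DIM('a) \<le> measure lborel B"
    by (simp add: v_def)
qed

text \<open>The cutoff at 0 keeps the function continuous and monotone when the inner radius of a
  shell is negative; the type argument carries the dimension.\<close>

definition ball_volume :: "'a::euclidean_space itself \<Rightarrow> real \<Rightarrow> real" where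
  "ball_volume _ r = unit_ball_vol DIM('a) * max 0 r ^ DIM('a)"

lemma measure_shell:
  assumes "a \<le> b"
  shows "measure lborel {y::'a::euclidean_space. a \<le> dist p y \<and> dist p y \<le> b} =
    ball_volume TYPE('a) b - ball_volume TYPE('a) a"
proof -
  have ball: "measure lborel (ball p a) = ball_volume TYPE('a) a" 
    by (cases "a \<ge> 0") (simp_all add: content_ball ball_empty zero_power ball_volume_def max_def)
  have cball: "measure lborel (cball p b) = ball_volume TYPE('a) b" 
    by (cases "b \<ge> 0") (simp_all add: content_cball cball_empty zero_power ball_volume_def max_def)
  have "{y. a \<le> dist p y \<and> dist p y \<le> b} = cball p b - ball p a" by auto
  moreover have "measure lborel (cball p b - ball p a) = measure lborel (cball p b) - measure lborel (ball p a)"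
    using assms by (intro measure_Diff) (use emeasure_bounded_finite[of "cball p b"] in auto)
  ultimately show ?thesis using ball cball by simp
qed

lemma continuous_ball_volume: "continuous_on S (ball_volume TYPE('a::euclidean_space))"
  unfolding ball_volume_def by (intro continuous_intros)

lemma card_grid_cube_le:
  "finite (grid N \<inter> cube m :: 'a::euclidean_space set)"
  "card (grid N \<inter> cube m :: 'a set) * (1 / (real N + 1)) ^ DIM('a) \<le> measure lborel (cube m :: 'a set)"
proof -
  have "cell N g \<subseteq> cube m" if "g \<in> grid N \<inter> cube m" for g :: 'a
  proof
    fix y assume "y \<in> cell N g"
    then have "grid_point N y \<in> cube m" using that unfolding mem_cell by blast
    then show "y \<in> cube m" by simp
  qed
  note * = card_grid_le[where A="grid N \<inter> cube m", OF _ this cube_borel bounded_cube]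
  show "finite (grid N \<inter> cube m :: 'a set)" by (rule *(1)) auto
  show "card (grid N \<inter> cube m :: 'a set) * (1 / (real N + 1)) ^ DIM('a)
      \<le> measure lborel (cube m :: 'a set)" by (rule *(2)) auto
qed

text \<open>\<open>e\<close> bounds the distance from a point to its corner, so the cells counted
  fit into the shell widened by \<open>e\<close> on both sides.\<close>

lemma card_grid_shell_le:
  fixes p :: "'a::euclidean_space"
  assumes "DIM('a) / (real N + 1) \<le> e" "a \<le> b"
  shows "finite {g \<in> grid N. a \<le> dist p g \<and> dist p g \<le> b}"
    "card {g \<in> grid N. a \<le> dist p g \<and> dist p g \<le> b} * (1 / (real N + 1)) ^ DIM('a)
      \<le> ball_volume TYPE('a) (b + e) - ball_volume TYPE('a) (a - e)"
proof -
  let ?A = "{g \<in> grid N. a \<le> dist p g \<and> dist p g \<le> b}"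
  let ?B = "{y. a - e \<le> dist p y \<and> dist p y \<le> b + e}"
  have sub: "cell N g \<subseteq> ?B" if "g \<in> ?A" for g
  proof
    fix y assume "y \<in> cell N g"
    then have "dist g y \<le> e" using dist_grid_point[where N=N and x=y] assms(1) by (auto simp: mem_cell)
    then show "y \<in> ?B"
      using that dist_triangle[of p g y] dist_triangle[of p y g] by (auto simp: dist_commute)
  qed
  have e: "e \<ge> 0" using assms(1) by (rule order_trans[rotated]) simp
  have B: "?B \<in> sets borel" by measurable
  have "bounded ?B" by (rule bounded_subset[of "cball p (b + e)"]) auto
  note * = card_grid_le[OF _ sub B this]
  show "finite ?A" by (rule *(1)) auto
  have "card ?A * (1 / (real N + 1)) ^ DIM('a) \<le> measure lborel ?B" by (rule *(2)) auto
  also have "\<dots> = ball_volume TYPE('a) (b + e) - ball_volume TYPE('a) (a - e)"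
    using assms(2) e by (intro measure_shell) simp
  finally show "card ?A * (1 / (real N + 1)) ^ DIM('a)
      \<le> ball_volume TYPE('a) (b + e) - ball_volume TYPE('a) (a - e)" .
qed

section \<open>Occupied cells\<close>

text \<open>Made for predicates of unknown measurability: up to a null set, \<open>P\<close> lies in
  the limit inferior of the \<open>U N\<close>, an event of probability at most
  \<open>\<epsilon>\<close>. Intersecting these for \<open>\<epsilon> = 1 / Suc k\<close> leaves a
  null set.\<close>

lemma (in prob_space) AE_not_if_eventually_in_small_events:
  assumes "\<And>\<epsilon>. \<epsilon> > 0 \<Longrightarrow> \<exists>U. (\<forall>N. U N \<in> events) \<and>
      (AE \<omega> in M. P \<omega> \<longrightarrow> (\<forall>\<^sub>F N in sequentially. \<omega> \<in> U N)) \<and>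
      (\<forall>\<^sub>F N in sequentially. prob (U N) \<le> \<epsilon>)"
  shows "AE \<omega> in M. \<not> P \<omega>"
proof -
  have "\<exists>V\<in>events. prob V \<le> 1 / real (Suc k) \<and> (AE \<omega> in M. P \<omega> \<longrightarrow> \<omega> \<in> V)" for k
  proof -
    obtain U where U: "\<And>N. U N \<in> events" "AE \<omega> in M. P \<omega> \<longrightarrow> (\<forall>\<^sub>F N in sequentially. \<omega> \<in> U N)"
      "\<forall>\<^sub>F N in sequentially. prob (U N) \<le> 1 / real (Suc k)"
      using assms[of "1 / real (Suc k)"] by auto
    define W where "W n = (\<Inter>N\<in>{n..}. U N)" for n
    define V where "V = (\<Union>n. W n)"
    have W: "W n \<in> events" for n unfolding W_def using U(1) by (intro sets.countable_INT') auto
    have "incseq W" unfolding W_def incseq_def by (auto intro: order_trans)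
    then have "(\<lambda>n. prob (W n)) \<longlonglongrightarrow> prob V"
      unfolding V_def using W by (intro finite_Lim_measure_incseq) auto
    moreover have "\<forall>\<^sub>F n in sequentially. prob (W n) \<le> 1 / real (Suc k)"
      using U(3)
    proof eventually_elim
      case (elim n)
      have "prob (W n) \<le> prob (U n)" using U(1) by (intro finite_measure_mono) (auto simp: W_def)
      then show ?case using elim by simp
    qed
    ultimately have "prob V \<le> 1 / real (Suc k)" by (rule tendsto_upperbound) simp
    moreover have "AE \<omega> in M. P \<omega> \<longrightarrow> \<omega> \<in> V"
      using U(2) by eventually_elim (auto simp: V_def W_def eventually_sequentially)
    moreover have "V \<in> events" unfolding V_def using W by blast
    ultimately show ?thesis by blast
  qed
  then obtain V where V: "\<And>k. V k \<in> events" "\<And>k. prob (V k) \<le> 1 / real (Suc k)"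
    "\<And>k. AE \<omega> in M. P \<omega> \<longrightarrow> \<omega> \<in> V k" by metis
  define Z where "Z = (\<Inter>k. V k)"
  have Z: "Z \<in> events" unfolding Z_def using V(1) by (intro sets.countable_INT') auto
  have "prob Z \<le> 0"
  proof (rule field_le_epsilon)
    fix e :: real assume "e > 0"
    then obtain k where k: "1 / real (Suc k) < e" using nat_approx_posE by metis
    have "prob Z \<le> prob (V k)" using V(1) by (intro finite_measure_mono) (auto simp: Z_def)
    then show "prob Z \<le> 0 + e" using V(2)[of k] k by simp
  qed
  then have "AE \<omega> in M. \<omega> \<notin> Z"
    using Z by (intro AE_not_in) (simp add: null_sets_def emeasure_eq_measure measure_le_0_iff)
  moreover have "AE \<omega> in M. \<forall>k. P \<omega> \<longrightarrow> \<omega> \<in> V k"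
    unfolding AE_all_countable using V(3) by blast
  ultimately show ?thesis by eventually_elim (auto simp: Z_def)
qed

text \<open>The Poisson mean of the count in one cell at intensity \<open>c\<close>.\<close>

definition cell_mean :: "'a::euclidean_space itself \<Rightarrow> real \<Rightarrow> nat \<Rightarrow> real" where
  "cell_mean _ c N = c * (1 / (real N + 1)) ^ DIM('a)"

context homogeneous_poisson_process
begin

text \<open>Phrased through the count because counts are the given random variables; for locally
  finite \<open>L \<omega>\<close> it says that the cell meets \<open>L \<omega>\<close>.\<close>

definition occupied :: "nat \<Rightarrow> 'w \<Rightarrow> 'a \<Rightarrow> bool" where
  "occupied N \<omega> g \<longleftrightarrow> card (L \<omega> \<inter> cell N g) \<noteq> 0"

lemma cell_count_measurable:
  "g \<in> grid N \<Longrightarrow> random_variable (count_space UNIV) (\<lambda>\<omega>. card (L \<omega> \<inter> cell N g))"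
  by (intro count_measurable cell_borel bounded_cell)

lemma occupied_events:
  assumes "g \<in> grid N" shows "{\<omega> \<in> space M. occupied N \<omega> g} \<in> events"
  unfolding occupied_def using cell_count_measurable[OF assms] by measurable

lemma prob_occupied:
  assumes "g \<in> grid N"
  shows "prob {\<omega> \<in> space M. occupied N \<omega> g = b} =
    (if b then 1 - exp (- cell_mean TYPE('a) intensity N) else exp (- cell_mean TYPE('a) intensity N))"
proof -
  have empty: "prob {\<omega> \<in> space M. \<not> occupied N \<omega> g} = exp (- cell_mean TYPE('a) intensity N)"
    using count_poisson[OF cell_borel[OF assms] bounded_cell, of 0] assms
    by (simp add: occupied_def measure_cell cell_mean_def)
  have "prob {\<omega> \<in> space M. occupied N \<omega> g} = 1 - prob {\<omega> \<in> space M. \<not> occupied N \<omega> g}"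
    using prob_neg[OF occupied_events[OF assms]] by simp
  then show ?thesis using empty by (cases b) simp_all
qed

lemma prob_occupied_pattern:
  assumes J: "finite J" "J \<subseteq> grid N"
  shows "prob {\<omega> \<in> space M. \<forall>g\<in>J. occupied N \<omega> g = c g} =
    (\<Prod>g\<in>J. if c g then 1 - exp (- cell_mean TYPE('a) intensity N) else exp (- cell_mean TYPE('a) intensity N))"
\<comment> \<open>The empty pattern is separate because an empty intersection would be the universe
  instead of \<open>space M\<close>.\<close>
proof (cases "J = {}")
  case True
  then show ?thesis by (simp add: prob_space)
next
  case False
  \<comment> \<open>Independence is given for families indexed by natural numbers, hence the
    enumeration of \<open>J\<close>.\<close>
  obtain e where e: "bij_betw e {0..<card J} J" using ex_bij_betw_nat_finite[OF J(1)] by blast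
  let ?I = "{0..<card J}"
  define A :: "nat \<Rightarrow> nat set" where "A i = (if c (e i) then - {0} else {0})" for i
  have eJ: "e i \<in> J" if "i \<in> ?I" for i using e that by (auto simp: bij_betw_def)
  have egrid: "e i \<in> grid N" if "i \<in> ?I" for i using eJ[OF that] J(2) by blast
  have indep: "indep_vars (\<lambda>_. count_space UNIV) (\<lambda>i \<omega>. card (L \<omega> \<inter> cell N (e i))) ?I"
  proof (rule count_indep)
    show "disjoint_family_on (\<lambda>i. cell N (e i)) ?I"
      using e by (auto simp: disjoint_family_on_def mem_cell bij_betw_def inj_on_def)
  qed (use egrid cell_borel bounded_cell in auto)
  have vimage: "(\<lambda>\<omega>. card (L \<omega> \<inter> cell N (e i))) -` A i \<inter> space M =
      {\<omega> \<in> space M. occupied N \<omega> (e i) = c (e i)}" for i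
    by (auto simp: A_def occupied_def split: if_splits)
  have "{\<omega> \<in> space M. \<forall>g\<in>J. occupied N \<omega> g = c g} =
      (\<Inter>i\<in>?I. (\<lambda>\<omega>. card (L \<omega> \<inter> cell N (e i))) -` A i \<inter> space M)"
  proof -
    have "(\<forall>g\<in>J. Q g) \<longleftrightarrow> (\<forall>i\<in>?I. Q (e i))" for Q
    proof -
      have "(\<forall>g\<in>e ` ?I. Q g) \<longleftrightarrow> (\<forall>i\<in>?I. Q (e i))" by simp
      then show ?thesis unfolding bij_betw_imp_surj_on[OF e] .
    qed
    moreover have "?I \<noteq> {}" using False J(1) by (simp add: card_gt_0_iff)
    ultimately show ?thesis unfolding vimage by auto
  qed
  also have "prob \<dots> = (\<Prod>i\<in>?I. prob ((\<lambda>\<omega>. card (L \<omega> \<inter> cell N (e i))) -` A i \<inter> space M))"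
    using False J(1) by (intro indep_varsD_finite[OF indep]) (auto simp: card_gt_0_iff)
  also have "\<dots> = (\<Prod>i\<in>?I. if c (e i) then 1 - exp (- cell_mean TYPE('a) intensity N) else exp (- cell_mean TYPE('a) intensity N))"
    unfolding vimage using egrid by (intro prod.cong refl prob_occupied) auto
  also have "\<dots> = (\<Prod>g\<in>J. if c g then 1 - exp (- cell_mean TYPE('a) intensity N) else exp (- cell_mean TYPE('a) intensity N))"
    using e by (rule prod.reindex_bij_betw)
  finally show ?thesis .
qed

text \<open>First-moment bound: \<open>1 - exp (- x) \<le> x\<close> bounds the occupation
  probability of a cell by its mean, independence gives the power for \<open>k\<close> distinct
  cells, and the union bound sums over \<open>T\<close>.\<close>

lemma prob_ex_all_occupied_le:
  assumes "finite T" and "\<And>t. t \<in> T \<Longrightarrow> finite t \<and> t \<subseteq> grid N \<and> card t = k" and "intensity > 0"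
  shows "{\<omega> \<in> space M. \<exists>t\<in>T. \<forall>g\<in>t. occupied N \<omega> g} \<in> events"
    and "prob {\<omega> \<in> space M. \<exists>t\<in>T. \<forall>g\<in>t. occupied N \<omega> g} \<le> card T * cell_mean TYPE('a) intensity N ^ k"
proof -
  let ?E = "\<lambda>t. {\<omega> \<in> space M. \<forall>g\<in>t. occupied N \<omega> g}"
  have E: "?E t \<in> events" if "t \<in> T" for t
    using assms(2)[OF that] by (intro sets.sets_Collect_finite_All occupied_events) auto
  have eq: "{\<omega> \<in> space M. \<exists>t\<in>T. \<forall>g\<in>t. occupied N \<omega> g} = (\<Union>t\<in>T. ?E t)" by auto
  show "{\<omega> \<in> space M. \<exists>t\<in>T. \<forall>g\<in>t. occupied N \<omega> g} \<in> events"
    unfolding eq using E assms(1) by auto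
  have "prob (\<Union>t\<in>T. ?E t) \<le> (\<Sum>t\<in>T. prob (?E t))"
    using E assms(1) by (intro finite_measure_subadditive_finite) auto
  also have "\<dots> \<le> (\<Sum>t\<in>T. cell_mean TYPE('a) intensity N ^ k)"
  proof (rule sum_mono)
    fix t assume t: "t \<in> T"
    have "prob (?E t) = (1 - exp (- cell_mean TYPE('a) intensity N)) ^ k"
      using prob_occupied_pattern[of t N "\<lambda>_. True"] assms(2)[OF t] by simp
    also have "\<dots> \<le> cell_mean TYPE('a) intensity N ^ k"
    proof (rule power_mono)
      show "1 - exp (- cell_mean TYPE('a) intensity N) \<le> cell_mean TYPE('a) intensity N" using exp_ge_add_one_self[of "- cell_mean TYPE('a) intensity N"] by simp
      show "0 \<le> 1 - exp (- cell_mean TYPE('a) intensity N)" using assms(3) by (simp add: cell_mean_def)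
    qed
    finally show "prob (?E t) \<le> cell_mean TYPE('a) intensity N ^ k" .
  qed
  finally show "prob {\<omega> \<in> space M. \<exists>t\<in>T. \<forall>g\<in>t. occupied N \<omega> g} \<le> card T * cell_mean TYPE('a) intensity N ^ k"
    unfolding eq by simp
qed

end

section \<open>Almost sure absence of isosceles triangles\<close>

text \<open>Supplies the distinct cells on which the product bound for occupation probabilities
  relies.\<close>

lemma eventually_inj_on_grid_point:
  fixes F :: "'a::euclidean_space set"
  assumes "finite F"
  shows "\<forall>\<^sub>F N in sequentially. inj_on (grid_point N) F"
proof -
  have "\<forall>\<^sub>F N in sequentially. x \<noteq> y \<longrightarrow> grid_point N x \<noteq> grid_point N y" for x y :: 'a
  proof (cases "x = y")
    case False
    then have "dist x y / 2 > 0" by simp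
    from eventually_mesh_less[OF this, where 'a='a] show ?thesis
    proof eventually_elim
      case (elim N)
      show ?case
      proof (intro impI notI)
        assume eq: "grid_point N x = grid_point N y"
        have "dist x y \<le> dist (grid_point N x) x + dist (grid_point N y) y"
          using dist_triangle2[of x y "grid_point N x"] by (simp add: eq dist_commute)
        then show False using elim dist_grid_point[of N x] dist_grid_point[of N y] by linarith
      qed
    qed
  qed simp
  then have "\<forall>\<^sub>F N in sequentially. \<forall>x\<in>F. \<forall>y\<in>F. x \<noteq> y \<longrightarrow> grid_point N x \<noteq> grid_point N y"
    using assms by (simp add: eventually_ball_finite_distrib)
  then show ?thesis by (rule eventually_mono) (auto simp: inj_on_def)
qed

lemma abs_dist_grid_point_diff:
  fixes x y :: "'a::euclidean_space"
  shows "\<bar>dist (grid_point N x) (grid_point N y) - dist x y\<bar> \<le> 2 * (DIM('a) / (real N + 1))"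
proof -
  have "dist (grid_point N x) (grid_point N y) \<le> dist (grid_point N x) x + dist x y + dist y (grid_point N y)"
    "dist x y \<le> dist x (grid_point N x) + dist (grid_point N x) (grid_point N y) + dist (grid_point N y) y"
    by (meson add_mono_thms_linordered_semiring(3) dist_triangle order_trans)+
  then show ?thesis using dist_grid_point[of N x] dist_grid_point[of N y] by (simp add: dist_commute)
qed

lemma mem_cube_if_norm_less: "norm x < real m \<Longrightarrow> x \<in> cube m"
  using Basis_le_norm[of _ x] by (fastforce simp: cube_def abs_le_iff)

lemma three_points_in_cube:
  fixes x y z :: "'a::euclidean_space"
  obtains m where "x \<in> cube m" "y \<in> cube m" "z \<in> cube m"
proof -
  obtain m :: nat where m: "norm x + norm y + norm z < real m" using reals_Archimedean2 by blast
  then have "norm x < real m" "norm y < real m" "norm z < real m"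
    using norm_ge_zero[of x] norm_ge_zero[of y] norm_ge_zero[of z] by linarith+
  then show ?thesis by (intro that[of m] mem_cube_if_norm_less)
qed

context homogeneous_poisson_process
begin

lemma occupied_grid_point:
  assumes "\<forall>B. bounded B \<longrightarrow> finite (L \<omega> \<inter> B)" "x \<in> L \<omega>"
  shows "occupied N \<omega> (grid_point N x)"
  using assms bounded_cell[of N "grid_point N x"] by (auto simp: occupied_def mem_cell)

text \<open>With cells of volume \<open>v\<close>, two corners in the cube can be chosen in at most
  \<open>(A / v)\<^sup>2\<close> ways, and the third lies in a thin shell holding at most
  \<open>\<eta> / v\<close> corners. Each triple is occupied with probability at most
  \<open>(intensity * v) ^ 3\<close>, so \<open>v\<close> cancels.\<close>

lemma AE_isosceles_free:
  assumes pos: "intensity > 0"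
  shows "AE \<omega> in M. isosceles_free (L \<omega>)"
proof -
  define P where "P m \<omega> \<longleftrightarrow> (\<exists>x y z. {x, y, z} \<subseteq> L \<omega> \<inter> cube m \<and> x \<noteq> y \<and> x \<noteq> z \<and> y \<noteq> z \<and>
      dist x y = dist x z)" for m \<omega>
  have "AE \<omega> in M. \<not> P m \<omega>" for m
  proof (rule AE_not_if_eventually_in_small_events)
    fix \<epsilon> :: real assume \<epsilon>: "\<epsilon> > 0"
    let ?V = "ball_volume TYPE('a)"
    define A where "A = measure lborel (cube m :: 'a set)"
    \<comment> \<open>The shell volume that can be afforded; the summand 1 keeps the denominator
      positive.\<close>
    define \<eta> where "\<eta> = \<epsilon> / (intensity ^ 3 * A\<^sup>2 + 1)"
    have den: "intensity ^ 3 * A\<^sup>2 + 1 > 0" using pos by (simp add: add_nonneg_pos)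
    have \<eta>: "\<eta> > 0" "intensity ^ 3 * A\<^sup>2 * \<eta> \<le> \<epsilon>"
      using \<epsilon> den by (simp_all add: \<eta>_def field_simps)
    obtain R where R: "\<And>x y. x \<in> cube m \<Longrightarrow> y \<in> cube m \<Longrightarrow> dist x (y::'a) \<le> R"
      using bounded_two_points[of "cube m"] bounded_cube by blast
    \<comment> \<open>One width must serve all shell radii in \<open>[0, R]\<close>; the interval
      leaves room for \<open>\<delta> \<le> 1\<close> on both sides.\<close>
    have "uniformly_continuous_on {-1..R+1} ?V"
      by (intro compact_uniformly_continuous continuous_ball_volume) simp
    then obtain d where d: "d > 0" "\<And>r s. r \<in> {-1..R+1} \<Longrightarrow> s \<in> {-1..R+1} \<Longrightarrow> dist s r < d \<Longrightarrow> dist (?V s) (?V r) < \<eta>"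
      using \<eta>(1) unfolding uniformly_continuous_on_def by metis
    define \<delta> where "\<delta> = min 1 (d / 3)"
    have \<delta>: "\<delta> > 0" "\<delta> \<le> 1" "2 * \<delta> < d" using d(1) by (auto simp: \<delta>_def)
    have V: "?V (r + \<delta>) - ?V (r - \<delta>) \<le> \<eta>" if "0 \<le> r" "r \<le> R" for r
      using d(2)[of "r - \<delta>" "r + \<delta>"] that \<delta> by (auto simp: dist_real_def)
    define C :: "nat \<Rightarrow> 'a set" where "C N = grid N \<inter> cube m" for N
    define Sh where "Sh N = (\<lambda>(g1, g2). {g3 \<in> grid N. dist g1 g2 - \<delta> / 2 \<le> dist g1 (g3::'a) \<and>
        dist g1 g3 \<le> dist g1 g2 + \<delta> / 2})" for N
    define S where "S N = Sigma (C N \<times> C N) (Sh N)" for N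
    define T where "T N = (\<lambda>((g1, g2), g3). {g1, g2, g3}) `
        {p \<in> S N. case p of ((g1, g2), g3) \<Rightarrow> g1 \<noteq> g2 \<and> g1 \<noteq> g3 \<and> g2 \<noteq> g3}" for N
    \<comment> \<open>Finiteness of \<open>T N\<close> is derived only for fine grids; as part of
      the definition it makes every \<open>U N\<close> an event.\<close>
    define U where "U N = {\<omega> \<in> space M. finite (T N) \<and> (\<exists>t\<in>T N. \<forall>g\<in>t. occupied N \<omega> g)}" for N
    define v where "v N = (1 / (real N + 1)) ^ DIM('a)" for N
    have v: "v N > 0" for N by (simp add: v_def)
    have T: "finite t \<and> t \<subseteq> grid N \<and> card t = 3" if "t \<in> T N" for t N
      using that by (auto simp: T_def S_def C_def Sh_def card_insert_if)
    have U: "U N \<in> events" for N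
      using prob_ex_all_occupied_le(1)[of "T N" N 3] T pos by (cases "finite (T N)") (auto simp: U_def)
    \<comment> \<open>Rounding changes a distance by at most twice the mesh bound, so two equal
      distances end up less than \<open>\<delta> / 2\<close> apart.\<close>
    have mesh: "\<forall>\<^sub>F N in sequentially. DIM('a) / (real N + 1) < \<delta> / 8"
      using \<delta> by (intro eventually_mesh_less) simp
    have T_card: "\<forall>\<^sub>F N in sequentially. finite (T N) \<and> card (T N) * v N ^ 3 \<le> A\<^sup>2 * \<eta>"
      using mesh
    proof eventually_elim
      case (elim N)
      have C: "finite (C N)" "card (C N) * v N \<le> A"
        using card_grid_cube_le[of N m] by (auto simp: C_def v_def A_def)
      have Sh: "finite (Sh N p)" "card (Sh N p) * v N \<le> \<eta>" if p_in: "p \<in> C N \<times> C N" for p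
      proof -
        obtain g1 g2 where p: "p = (g1, g2)" "g1 \<in> cube m" "g2 \<in> cube m"
          using p_in by (auto simp: C_def)
        let ?a = "dist g1 g2 - \<delta> / 2" and ?b = "dist g1 g2 + \<delta> / 2"
        have "DIM('a) / (real N + 1) \<le> \<delta> / 2" "?a \<le> ?b" using elim \<delta>(1) by linarith+
        note * = card_grid_shell_le[OF this, of g1]
        show "finite (Sh N p)" using *(1) by (simp add: Sh_def p)
        have "card (Sh N p) * v N \<le> ?V (?b + \<delta> / 2) - ?V (?a - \<delta> / 2)"
          using *(2) by (simp add: Sh_def p v_def)
        also have "\<dots> \<le> \<eta>" using V[of "dist g1 g2"] R p by (simp add: algebra_simps)
        finally show "card (Sh N p) * v N \<le> \<eta>" .
      qed
      have finS: "finite (S N)" unfolding S_def using C(1) Sh(1) by blast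
      have "card (S N) * v N = (\<Sum>p\<in>C N \<times> C N. card (Sh N p) * v N)"
        unfolding S_def using C(1) Sh(1) by (subst card_SigmaI) (auto simp: sum_distrib_right)
      also have "\<dots> \<le> (\<Sum>p\<in>C N \<times> C N. \<eta>)" by (rule sum_mono) (rule Sh(2))
      also have "\<dots> = real (card (C N)) * real (card (C N)) * \<eta>" by (simp add: card_cartesian_product)
      finally have S: "card (S N) * v N \<le> real (card (C N)) * real (card (C N)) * \<eta>" .
      have "card (T N) \<le> card (S N)"
        unfolding T_def by (rule order_trans[OF card_image_le card_mono]) (use finS in auto)
      then have "card (T N) * v N ^ 3 \<le> card (S N) * v N ^ 3" using v by simp
      also have "\<dots> = (card (S N) * v N) * (v N)\<^sup>2" by (simp add: power2_eq_square power3_eq_cube)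
      also have "\<dots> \<le> (real (card (C N)) * real (card (C N)) * \<eta>) * (v N)\<^sup>2"
        using S by (rule mult_right_mono) simp
      also have "\<dots> = (card (C N) * v N)\<^sup>2 * \<eta>" by (simp add: power2_eq_square)
      also have "\<dots> \<le> A\<^sup>2 * \<eta>"
        using C(2) v[of N] \<eta>(1) by (intro mult_right_mono power_mono) auto
      finally show ?case using finS by (simp add: T_def)
    qed
    show "\<exists>U. (\<forall>N. U N \<in> events) \<and>
        (AE \<omega> in M. P m \<omega> \<longrightarrow> (\<forall>\<^sub>F N in sequentially. \<omega> \<in> U N)) \<and>
        (\<forall>\<^sub>F N in sequentially. prob (U N) \<le> \<epsilon>)"
    proof (intro exI[of _ U] conjI allI U)
      show "\<forall>\<^sub>F N in sequentially. prob (U N) \<le> \<epsilon>"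
        using T_card
      proof eventually_elim
        case (elim N)
        have "prob (U N) \<le> card (T N) * cell_mean TYPE('a) intensity N ^ 3"
          using prob_ex_all_occupied_le(2)[of "T N" N 3] T pos elim by (auto simp: U_def)
        also have "\<dots> = intensity ^ 3 * (card (T N) * v N ^ 3)"
          by (simp add: cell_mean_def v_def power_mult_distrib)
        also have "\<dots> \<le> intensity ^ 3 * (A\<^sup>2 * \<eta>)" using elim pos by (intro mult_left_mono) auto
        finally show ?case using \<eta>(2) by (simp add: mult.assoc)
      qed
      show "AE \<omega> in M. P m \<omega> \<longrightarrow> (\<forall>\<^sub>F N in sequentially. \<omega> \<in> U N)"
        using locally_finite AE_space
      proof eventually_elim
        case (elim \<omega>)
        show ?case
        proof
          assume "P m \<omega>"
          then obtain x y z where xyz: "{x, y, z} \<subseteq> L \<omega> \<inter> cube m" "x \<noteq> y" "x \<noteq> z" "y \<noteq> z"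
            "dist x y = dist x z" unfolding P_def by blast
          have "\<forall>\<^sub>F N in sequentially. inj_on (grid_point N) {x, y, z}"
            by (rule eventually_inj_on_grid_point) simp
          from this mesh T_card show "\<forall>\<^sub>F N in sequentially. \<omega> \<in> U N"
          proof eventually_elim
            case (elim N)
            let ?g = "grid_point N"
            have "?g x \<noteq> ?g y" "?g x \<noteq> ?g z" "?g y \<noteq> ?g z" using elim(1) xyz by (auto simp: inj_on_def)
            moreover have "dist (?g x) (?g y) - \<delta> / 2 \<le> dist (?g x) (?g z)"
              "dist (?g x) (?g z) \<le> dist (?g x) (?g y) + \<delta> / 2"
              using xyz(5) elim(2) abs_dist_grid_point_diff[of N x y] abs_dist_grid_point_diff[of N x z]
              by linarith+
            then have "((?g x, ?g y), ?g z) \<in> S N" using xyz(1) by (auto simp: S_def C_def Sh_def)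
            ultimately have "{?g x, ?g y, ?g z} \<in> T N" using \<open>((?g x, ?g y), ?g z) \<in> S N\<close> by (force simp: T_def)
            moreover have "\<forall>g\<in>{?g x, ?g y, ?g z}. occupied N \<omega> g"
              using xyz \<open>\<forall>B. bounded B \<longrightarrow> finite (L \<omega> \<inter> B)\<close> by (auto intro: occupied_grid_point)
            ultimately show ?case using elim(3) \<open>\<omega> \<in> space M\<close> unfolding U_def by blast
          qed
        qed
      qed
    qed
  qed
  then have "AE \<omega> in M. \<forall>m. \<not> P m \<omega>" unfolding AE_all_countable by blast
  then show ?thesis
  proof eventually_elim
    case (elim \<omega>)
    show ?case
      unfolding isosceles_free_def
    proof (intro ballI impI, rule ccontr)
      fix x y z assume *: "x \<in> L \<omega>" "y \<in> L \<omega>" "z \<in> L \<omega>" "dist x y = dist x z" "y \<noteq> z"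
      obtain m where "x \<in> cube m" "y \<in> cube m" "z \<in> cube m" by (rule three_points_in_cube)
      then have "P m \<omega>" unfolding P_def using * by (intro exI[of _ x] exI[of _ y] exI[of _ z]) auto
      then show False using elim by blast
    qed
  qed
qed

end

section \<open>Walks and bounded components in the shell graph\<close>

lemma card_walks_le:
  fixes K :: real
  assumes nbr: "\<And>g. finite {h \<in> G. r g h} \<and> card {h \<in> G. r g h} \<le> K"
    and "finite A"
  shows "finite {t. length t = Suc n \<and> set t \<subseteq> G \<and> hd t \<in> A \<and> successively r t}"
    and "card {t. length t = Suc n \<and> set t \<subseteq> G \<and> hd t \<in> A \<and> successively r t} \<le> card A * K ^ n"
proof -
  define w where "w n g = {t. length t = Suc n \<and> set t \<subseteq> G \<and> hd t = g \<and> successively r t}" for n g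
  have K: "K \<ge> 0" using nbr[of undefined] of_nat_0_le_iff order_trans by blast
  have w: "finite (w n g) \<and> card (w n g) \<le> K ^ n" for n g
  proof (induction n arbitrary: g)
    case 0
    have "w 0 g \<subseteq> {[g]}" by (auto simp: w_def length_Suc_conv)
    then have "finite (w 0 g)" "card (w 0 g) \<le> card {[g]}"
      by (rule finite_subset, simp) (rule card_mono[OF _ \<open>w 0 g \<subseteq> {[g]}\<close>], simp)
    then show ?case by simp
  next
    case (Suc n)
    let ?H = "{h \<in> G. r g h}"
    have sub: "w (Suc n) g \<subseteq> (\<Union>h\<in>?H. (#) g ` w n h)"
    proof
      fix t assume "t \<in> w (Suc n) g"
      then obtain h s where "t = g # h # s" "h \<in> ?H" "h # s \<in> w n h"
        unfolding w_def by (auto simp: length_Suc_conv)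
      then show "t \<in> (\<Union>h\<in>?H. (#) g ` w n h)" by blast
    qed
    have fin: "finite (\<Union>h\<in>?H. (#) g ` w n h)" using nbr[of g] Suc.IH by auto
    have "card (w (Suc n) g) \<le> card (\<Union>h\<in>?H. (#) g ` w n h)" by (rule card_mono[OF fin sub])
    also have "\<dots> \<le> (\<Sum>h\<in>?H. card ((#) g ` w n h))" using nbr[of g] by (intro card_UN_le) auto
    also have "\<dots> = (\<Sum>h\<in>?H. card (w n h))" by (simp add: card_image)
    finally have "card (w (Suc n) g) \<le> (\<Sum>h\<in>?H. real (card (w n h)))"
      by (simp flip: of_nat_sum)
    also have "\<dots> \<le> (\<Sum>h\<in>?H. K ^ n)" using Suc.IH by (intro sum_mono) auto
    also have "\<dots> \<le> K * K ^ n" using nbr[of g] K by (simp add: mult_right_mono)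
    finally show ?case using finite_subset[OF sub fin] by simp
  qed
  have eq: "{t. length t = Suc n \<and> set t \<subseteq> G \<and> hd t \<in> A \<and> successively r t} = (\<Union>g\<in>A. w n g)"
    by (auto simp: w_def)
  show "finite {t. length t = Suc n \<and> set t \<subseteq> G \<and> hd t \<in> A \<and> successively r t}"
    unfolding eq using w assms(2) by blast
  have "card (\<Union>g\<in>A. w n g) \<le> (\<Sum>g\<in>A. card (w n g))" by (rule card_UN_le[OF assms(2)])
  then have "card (\<Union>g\<in>A. w n g) \<le> (\<Sum>g\<in>A. real (card (w n g)))" by (simp flip: of_nat_sum)
  also have "\<dots> \<le> (\<Sum>g\<in>A. K ^ n)" using w by (intro sum_mono) auto
  finally show "card {t. length t = Suc n \<and> set t \<subseteq> G \<and> hd t \<in> A \<and> successively r t} \<le> card A * K ^ n"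
    unfolding eq by simp
qed

lemma rtrancl_path_successively: "rtrancl_path r x ys y \<Longrightarrow> successively r (x # ys)"
  by (induction rule: rtrancl_path.induct) auto

text \<open>Carries no vertex set, so that it serves both walks in \<open>L\<close> and walks of
  grid corners.\<close>

definition shell_edge :: "real \<Rightarrow> real \<Rightarrow> 'a::metric_space \<Rightarrow> 'a \<Rightarrow> bool" where
  "shell_edge a b x y \<longleftrightarrow> a \<le> dist x y \<and> dist x y \<le> b"

definition edge_in :: "'a::metric_space set \<Rightarrow> real \<Rightarrow> real \<Rightarrow> 'a \<Rightarrow> 'a \<Rightarrow> bool" where
  "edge_in L a b x y \<longleftrightarrow> x \<in> L \<and> y \<in> L \<and> shell_edge a b x y"

lemma rtrancl_path_dist_le:
  fixes b :: real
  assumes "rtrancl_path (edge_in L a b) x ys y"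
  shows "set ys \<subseteq> L \<and> dist x y \<le> length ys * b"
  using assms
proof (induction rule: rtrancl_path.induct)
  case (step x y ys z)
  then show ?case using dist_triangle[of x z y]
    by (auto simp: edge_in_def shell_edge_def algebra_simps)
qed simp

text \<open>A vertex beyond distance \<open>n * b\<close> takes at least \<open>n\<close> steps of
  length at most \<open>b\<close>; removing loops from the path and cutting it after
  \<open>n\<close> steps gives the walk.\<close>

lemma distinct_walk_if_unbounded_component:
  assumes "\<not> bounded {y. (edge_in L a b)\<^sup>*\<^sup>* x y}" "x \<in> L" "b \<ge> 0"
  obtains t where "length t = Suc n" "set t \<subseteq> L" "hd t = x" "successively (shell_edge a b) t" "distinct t"
proof -
  obtain y where y: "(edge_in L a b)\<^sup>*\<^sup>* x y" "dist x y > n * b"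
    using assms(1) unfolding bounded_def by (meson mem_Collect_eq not_le)
  obtain zs where "rtrancl_path (edge_in L a b) x zs y"
    using y(1) by (auto simp: rtranclp_eq_rtrancl_path)
  then obtain ys where ys: "rtrancl_path (edge_in L a b) x ys y" "distinct (x # ys)"
    by (rule rtrancl_path_distinct)
  note path = rtrancl_path_dist_le[OF ys(1)]
  have "length ys \<ge> n"
  proof (rule ccontr)
    assume "\<not> length ys \<ge> n"
    then have "length ys * b \<le> n * b" using assms(3) by (intro mult_right_mono) auto
    then show False using path y(2) by linarith
  qed
  let ?t = "take (Suc n) (x # ys)"
  have succ: "successively (edge_in L a b) (x # ys)" by (rule rtrancl_path_successively[OF ys(1)])
  have "successively (edge_in L a b) ?t"
    using succ by (metis append_take_drop_id successively_append_iff)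
  then have "successively (shell_edge a b) ?t"
    by (rule successively_mono) (simp add: edge_in_def)
  moreover have "set ?t \<subseteq> L" using path assms(2) set_take_subset[of "Suc n" "x # ys"] by auto
  moreover have "distinct ?t" using ys(2) by (rule distinct_take)
  moreover have "length ?t = Suc n" "hd ?t = x" using \<open>length ys \<ge> n\<close> by simp_all
  ultimately show ?thesis using that by blast
qed

context homogeneous_poisson_process
begin

text \<open>
  If each point expects fewer than one neighbour, then the expected number of self-avoiding walks
  of length \<open>n\<close> from a bounded set decays exponentially in \<open>n\<close>.
\<close>

lemma AE_bounded_components:
  assumes pos: "intensity > 0" and ab: "a \<le> b" "b \<ge> 0"
    and thin: "intensity * (ball_volume TYPE('a) b - ball_volume TYPE('a) a) < 1"
  shows "AE \<omega> in M. \<forall>x\<in>L \<omega>. bounded {y. (edge_in (L \<omega>) a b)\<^sup>*\<^sup>* x y}"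
proof -
  let ?V = "ball_volume TYPE('a)"
  define P where "P m \<omega> \<longleftrightarrow> (\<exists>x\<in>L \<omega> \<inter> cube m. \<not> bounded {y. (edge_in (L \<omega>) a b)\<^sup>*\<^sup>* x y})" for m \<omega>
  \<comment> \<open>The volume is continuous in the radii, so the strict bound survives a slight
    widening of the shell.\<close>
  have "((\<lambda>e. intensity * (?V (b + e) - ?V (a - e))) \<longlongrightarrow> intensity * (?V (b + 0) - ?V (a - 0))) (at_right 0)"
    unfolding ball_volume_def by (intro tendsto_intros)
  then have "\<forall>\<^sub>F e in at_right 0. intensity * (?V (b + e) - ?V (a - e)) < 1"
    using thin by (intro order_tendstoD(2)) auto
  then obtain e0 where e0: "e0 > 0" "\<And>e. 0 < e \<Longrightarrow> e < e0 \<Longrightarrow> intensity * (?V (b + e) - ?V (a - e)) < 1"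
    unfolding eventually_at_right_field by auto
  define e where "e = e0 / 4"
  \<comment> \<open>One \<open>e\<close> absorbs the rounding of edges to corners, the other the
    passage from corners to their cells.\<close>
  define \<theta> where "\<theta> = intensity * (?V (b + 2 * e) - ?V (a - 2 * e))"
  have e: "e > 0" "\<theta> < 1" using e0(1) e0(2)[of "2 * e"] by (auto simp: e_def \<theta>_def)
  have "?V (a - 2 * e) \<le> ?V (b + 2 * e)"
    unfolding ball_volume_def using ab e by (intro mult_left_mono power_mono) auto
  then have \<theta>: "\<theta> \<ge> 0" using pos by (simp add: \<theta>_def)
  have "AE \<omega> in M. \<not> P m \<omega>" for m
  proof (rule AE_not_if_eventually_in_small_events)
    fix \<epsilon> :: real assume \<epsilon>: "\<epsilon> > 0"
    define A where "A = measure lborel (cube m :: 'a set)"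
    have "(\<lambda>n. intensity * A * \<theta> ^ n) \<longlonglongrightarrow> intensity * A * 0"
      using e \<theta> by (intro tendsto_intros LIMSEQ_realpow_zero)
    then have "\<forall>\<^sub>F n in sequentially. intensity * A * \<theta> ^ n < \<epsilon>"
      using \<epsilon> by (intro order_tendstoD(2)) auto
    then obtain n where n: "intensity * A * \<theta> ^ n < \<epsilon>"
      by (auto simp: eventually_sequentially)
    define C :: "nat \<Rightarrow> 'a set" where "C N = grid N \<inter> cube m" for N
    define W where "W N = {t. length t = Suc n \<and> set t \<subseteq> grid N \<and> hd t \<in> C N \<and>
        successively (shell_edge (a - e) (b + e)) t}" for N
    define T where "T N = set ` {t \<in> W N. distinct t}" for N
    define U where "U N = {\<omega> \<in> space M. finite (T N) \<and> (\<exists>t\<in>T N. \<forall>g\<in>t. occupied N \<omega> g)}" for N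
    define v where "v N = (1 / (real N + 1)) ^ DIM('a)" for N
    have v: "v N > 0" for N by (simp add: v_def)
    have T: "finite t \<and> t \<subseteq> grid N \<and> card t = Suc n" if "t \<in> T N" for t N
      using that by (auto simp: T_def W_def distinct_card)
    have U: "U N \<in> events" for N
      using prob_ex_all_occupied_le(1)[of "T N" N "Suc n"] T pos by (cases "finite (T N)") (auto simp: U_def)
    have mesh: "\<forall>\<^sub>F N in sequentially. DIM('a) / (real N + 1) < e / 2"
      using e by (intro eventually_mesh_less) simp
    have T_card: "\<forall>\<^sub>F N in sequentially. finite (T N) \<and>
        card (T N) * cell_mean TYPE('a) intensity N ^ Suc n \<le> \<epsilon>"
      using mesh
    proof eventually_elim
      case (elim N)
      let ?K = "(?V (b + 2 * e) - ?V (a - 2 * e)) / v N"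
      have C: "finite (C N)" "card (C N) * v N \<le> A"
        using card_grid_cube_le[of N m] by (auto simp: C_def v_def A_def)
      have nbr: "finite {h \<in> grid N. shell_edge (a - e) (b + e) g h} \<and>
          card {h \<in> grid N. shell_edge (a - e) (b + e) g h} \<le> ?K" for g :: 'a
      proof -
        have "DIM('a) / (real N + 1) \<le> e" "a - e \<le> b + e" using elim e ab by linarith+
        from card_grid_shell_le[OF this, of g] show ?thesis
          using v[of N] by (simp add: shell_edge_def v_def field_simps)
      qed
      note walks = card_walks_le[where r = "shell_edge (a - e) (b + e)" and G = "grid N" and n = n, OF nbr C(1), folded W_def]
      have "card (T N) \<le> card (W N)"
        unfolding T_def by (rule order_trans[OF card_image_le card_mono]) (use walks(1) in auto)
      then have "card (T N) * cell_mean TYPE('a) intensity N ^ Suc n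
          \<le> card (C N) * ?K ^ n * cell_mean TYPE('a) intensity N ^ Suc n"
        using walks(2) pos by (intro mult_right_mono) (auto simp: cell_mean_def)
      \<comment> \<open>Of the \<open>n + 1\<close> cells, the first contributes at most
        \<open>A * intensity\<close> and each further one a factor \<open>\<theta>\<close>.\<close>
      also have "\<dots> = card (C N) * v N * intensity * (?K * (intensity * v N)) ^ n"
      proof -
        have "c * K ^ n * (i * w) ^ Suc n = c * w * i * (K * (i * w)) ^ n" for c K i w :: real
          by (simp add: power_mult_distrib mult_ac)
        then show ?thesis unfolding cell_mean_def v_def .
      qed
      also have "?K * (intensity * v N) = \<theta>" using v[of N] by (simp add: \<theta>_def)
      also have "card (C N) * v N * intensity * \<theta> ^ n \<le> A * intensity * \<theta> ^ n"
        using C(2) pos \<theta> by (intro mult_right_mono) auto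
      finally show ?case using n walks(1) by (simp add: T_def mult.commute)
    qed
    show "\<exists>U. (\<forall>N. U N \<in> events) \<and>
        (AE \<omega> in M. P m \<omega> \<longrightarrow> (\<forall>\<^sub>F N in sequentially. \<omega> \<in> U N)) \<and>
        (\<forall>\<^sub>F N in sequentially. prob (U N) \<le> \<epsilon>)"
    proof (intro exI[of _ U] conjI allI U)
      show "\<forall>\<^sub>F N in sequentially. prob (U N) \<le> \<epsilon>"
        using T_card
      proof eventually_elim
        case (elim N)
        have "prob (U N) \<le> card (T N) * cell_mean TYPE('a) intensity N ^ Suc n"
          using prob_ex_all_occupied_le(2)[of "T N" N "Suc n"] T pos elim by (auto simp: U_def)
        then show ?case using elim by linarith
      qed
      show "AE \<omega> in M. P m \<omega> \<longrightarrow> (\<forall>\<^sub>F N in sequentially. \<omega> \<in> U N)"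
        using locally_finite AE_space
      proof eventually_elim
        case (elim \<omega>)
        show ?case
        proof
          assume "P m \<omega>"
          then obtain x where x: "x \<in> L \<omega>" "x \<in> cube m" "\<not> bounded {y. (edge_in (L \<omega>) a b)\<^sup>*\<^sup>* x y}"
            unfolding P_def by blast
          obtain t where t: "length t = Suc n" "set t \<subseteq> L \<omega>" "hd t = x"
            "successively (shell_edge a b) t" "distinct t"
            using distinct_walk_if_unbounded_component[OF x(3,1) ab(2)] .
          have "\<forall>\<^sub>F N in sequentially. inj_on (grid_point N) (set t)"
            by (rule eventually_inj_on_grid_point) simp
          from this mesh T_card show "\<forall>\<^sub>F N in sequentially. \<omega> \<in> U N"
          proof eventually_elim
            case (elim N)
            let ?t = "map (grid_point N) t"
            have "t \<noteq> []" using t(1) by auto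
            have "successively (shell_edge (a - e) (b + e)) ?t"
              unfolding successively_map
            proof (rule successively_mono[OF t(4)])
              fix u w :: 'a assume "shell_edge a b u w"
              then show "shell_edge (a - e) (b + e) (grid_point N u) (grid_point N w)"
                using elim(2) abs_dist_grid_point_diff[of N u w] unfolding shell_edge_def by linarith
            qed
            then have "?t \<in> W N"
              using t(1,3) x(2) \<open>t \<noteq> []\<close> by (auto simp: W_def C_def hd_map)
            moreover have "distinct ?t" using t(5) elim(1) by (simp add: distinct_map)
            ultimately have "set ?t \<in> T N" unfolding T_def by blast
            moreover have "\<forall>g\<in>set ?t. occupied N \<omega> g"
              using t(2) \<open>\<forall>B. bounded B \<longrightarrow> finite (L \<omega> \<inter> B)\<close> by (auto intro: occupied_grid_point)
            ultimately show ?case using elim(3) \<open>\<omega> \<in> space M\<close> unfolding U_def by blast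
          qed
        qed
      qed
    qed
  qed
  then have "AE \<omega> in M. \<forall>m. \<not> P m \<omega>" unfolding AE_all_countable by blast
  then show ?thesis
  proof eventually_elim
    case (elim \<omega>)
    show ?case
    proof
      fix x assume "x \<in> L \<omega>"
      moreover obtain m where "x \<in> cube m" by (rule three_points_in_cube)
      ultimately show "bounded {y. (edge_in (L \<omega>) a b)\<^sup>*\<^sup>* x y}" using elim unfolding P_def by blast
    qed
  qed
qed

end

section \<open>Termination of play\<close>

lemma mono_ball_volume: "r \<le> s \<Longrightarrow> ball_volume TYPE('a::euclidean_space) r \<le> ball_volume TYPE('a) s"
  unfolding ball_volume_def by (intro mult_left_mono power_mono) auto

text \<open>Rational radii leave only countably many null sets to discard. The contradiction is
  counted in distances: an infinite play would realize infinitely many among the finitely many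
  points of one component.\<close>

lemma terminating_if_bounded_components:
  fixes L :: "'a::euclidean_space set" and c :: real
  assumes fin: "\<forall>B. bounded B \<longrightarrow> finite (L \<inter> B)" and "c \<ge> 0"
    and comp: "\<And>a b x. a \<in> \<rat> \<Longrightarrow> b \<in> \<rat> \<Longrightarrow> a \<le> b \<Longrightarrow> b \<ge> 0 \<Longrightarrow>
      c * (ball_volume TYPE('a) b - ball_volume TYPE('a) a) < 1 \<Longrightarrow> x \<in> L \<Longrightarrow>
      bounded {y. (edge_in L a b)\<^sup>*\<^sup>* x y}"
    and xy: "x \<in> L" "y \<in> L"
  shows "terminating L (TwoFrogs x y)"
proof (rule ccontr)
  let ?V = "ball_volume TYPE('a)"
  assume not_term: "\<not> terminating L (TwoFrogs x y)"
  define R where "R p q \<longleftrightarrow> (\<exists>x y x' y'. p = (x, y) \<and> q = (x', y') \<and> x' \<in> L \<and> y' \<in> L \<and>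
      legal_move L (TwoFrogs x y) (TwoFrogs x' y'))" for p q
  define Q where "Q p \<longleftrightarrow> (\<exists>x y. p = (x, y) \<and> x \<in> L \<and> y \<in> L \<and> \<not> terminating L (TwoFrogs x y))" for p
  have "\<exists>f. \<forall>n. Q (f n) \<and> R (f n) (f (Suc n))"
  proof (rule dependent_nat_choice)
    show "\<exists>p. Q p" using not_term xy by (auto simp: Q_def)
    fix p n assume "Q p"
    then obtain x y where p: "p = (x, y)" "x \<in> L" "y \<in> L" "\<not> terminating L (TwoFrogs x y)"
      by (auto simp: Q_def)
    obtain q where q: "legal_move L (TwoFrogs x y) q" "\<not> terminating L q"
      using p(4) by (rule not_accp_down)
    from q(1) obtain x' y' where "q = TwoFrogs x' y'" "x' \<in> L" "y' \<in> L"
      using p(2,3) by cases auto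
    then show "\<exists>q. Q q \<and> R p q" using p q by (auto simp: Q_def R_def)
  qed
  then obtain f where f: "\<And>n. Q (f n)" "\<And>n. R (f n) (f (Suc n))" by blast
  define X Y where "X n = fst (f n)" and "Y n = snd (f n)" for n
  have XY: "X n \<in> L" "Y n \<in> L" for n using f(1)[of n] by (auto simp: Q_def X_def Y_def)
  have move: "legal_move L (TwoFrogs (X n) (Y n)) (TwoFrogs (X (Suc n)) (Y (Suc n)))" for n
    using f(2)[of n] by (auto simp: R_def X_def Y_def)
  have share: "X (Suc n) = X n \<or> Y (Suc n) = Y n" for n
    using move[of n] by (auto elim: legal_move_TwoFrogsE)
  define d where "d n = dist (X n) (Y n)" for n
  have d_dec: "d (Suc n) < d n" for n
    using move[of n] by (auto elim: legal_move_TwoFrogsE simp: d_def)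
  have "decseq d" using d_dec by (intro decseq_SucI less_imp_le)
  then obtain \<rho> where \<rho>: "d \<longlonglongrightarrow> \<rho>" "\<And>n. \<rho> \<le> d n"
    using decseq_convergent[of d 0] by (auto simp: d_def)
  have "\<rho> \<ge> 0" using \<rho>(1) by (rule LIMSEQ_le_const) (auto simp: d_def)
  \<comment> \<open>As \<open>e\<close> tends to 0, the shell around \<open>\<rho>\<close>
    degenerates to a sphere or a point, of volume 0.\<close>
  have "((\<lambda>e. c * (?V (\<rho> + e) - ?V (\<rho> - e))) \<longlongrightarrow> c * (?V (\<rho> + 0) - ?V (\<rho> - 0))) (at_right 0)"
    unfolding ball_volume_def by (intro tendsto_intros)
  then have "\<forall>\<^sub>F e in at_right 0. c * (?V (\<rho> + e) - ?V (\<rho> - e)) < 1"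
    by (intro order_tendstoD(2)) auto
  then obtain e0 where e0: "e0 > 0" "\<And>e. 0 < e \<Longrightarrow> e < e0 \<Longrightarrow> c * (?V (\<rho> + e) - ?V (\<rho> - e)) < 1"
    unfolding eventually_at_right_field by auto
  define e where "e = e0 / 2"
  have e: "e > 0" "c * (?V (\<rho> + e) - ?V (\<rho> - e)) < 1" using e0 by (auto simp: e_def)
  obtain a where a: "a \<in> \<rat>" "\<rho> - e < a" "a < \<rho>" using Rats_dense_in_real[of "\<rho> - e" \<rho>] e by auto
  obtain b where b: "b \<in> \<rat>" "\<rho> < b" "b < \<rho> + e" using Rats_dense_in_real[of \<rho> "\<rho> + e"] e by auto
  have "?V b - ?V a \<le> ?V (\<rho> + e) - ?V (\<rho> - e)"
    using a b by (intro diff_mono mono_ball_volume) auto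
  then have thin: "c * (?V b - ?V a) < 1" using e(2) \<open>c \<ge> 0\<close> mult_left_mono by fastforce
  have "\<forall>\<^sub>F n in sequentially. d n < b" using \<rho>(1) b(2) by (rule order_tendstoD(2))
  then obtain k where k: "\<And>n. n \<ge> k \<Longrightarrow> d n < b" by (auto simp: eventually_sequentially)
  have edge: "edge_in L a b (X n) (Y n)" "edge_in L a b (Y n) (X n)" if "n \<ge> k" for n
    using k[OF that] \<rho>(2)[of n] a XY[of n] by (auto simp: edge_in_def shell_edge_def d_def dist_commute)
  let ?C = "{y. (edge_in L a b)\<^sup>*\<^sup>* (X k) y}"
  \<comment> \<open>The frog that stays connects the new pair to the component, and the edge between
    the two frogs then brings in the one that moved.\<close>
  have reach: "X (k + n) \<in> ?C \<and> Y (k + n) \<in> ?C" for n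
  proof (induction n)
    case 0
    show ?case using edge[of k] by auto
  next
    case (Suc n)
    then show ?case
      using share[of "k + n"] edge[of "Suc (k + n)"] by (auto intro: rtranclp.rtrancl_into_rtrancl)
  qed
  have "finite (L \<inter> ?C)"
    using fin comp[OF a(1) b(1) _ _ thin XY(1)[of k]] a b \<open>\<rho> \<ge> 0\<close> by auto
  then have "finite ((\<lambda>(x, y). dist x y) ` ((L \<inter> ?C) \<times> (L \<inter> ?C)))" by blast
  moreover have "range (\<lambda>n. d (k + n)) \<subseteq> (\<lambda>(x, y). dist x y) ` ((L \<inter> ?C) \<times> (L \<inter> ?C))"
    using reach XY unfolding d_def by (force intro: image_eqI)
  ultimately have "finite (range (\<lambda>n. d (k + n)))" by (rule rev_finite_subset)
  moreover have "inj (\<lambda>n. d (k + n))"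
  proof -
    have "strict_mono (\<lambda>n. - d (k + n))" using d_dec by (simp add: strict_mono_Suc_iff)
    then have "inj (\<lambda>n. - d (k + n))" by (rule strict_mono_imp_inj_on)
    then show ?thesis by (simp add: inj_on_def)
  qed
  ultimately show False using finite_imageD infinite_UNIV_nat by blast
qed

section \<open>Points without a nearby partner\<close>

interpretation grid: approximation_scheme "grid_point :: nat \<Rightarrow> 'a::euclidean_space \<Rightarrow> 'a" cube
proof
  fix e :: real assume "e > 0"
  from eventually_mesh_less[OF this, where 'a = 'a]
  show "\<forall>\<^sub>F N in sequentially. \<forall>x::'a. dist (grid_point N x) x < e"
    by eventually_elim (meson dist_grid_point le_less_trans)
next
  fix x :: 'a
  obtain m :: nat where "norm x < real m" using reals_Archimedean2 by blast
  then show "\<forall>\<^sub>F N in sequentially. x \<in> cube N"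
    by (intro eventually_sequentiallyI[of m] mem_cube_if_norm_less) simp
qed

text \<open>
  Having no partner at all is not a local property, but having none inside \<open>cube m\<close> is a limit of
  events that depend on finitely many cells; this gives measurability up to null sets.
\<close>

definition unmatched_within :: "nat \<Rightarrow> 'a::euclidean_space set \<Rightarrow> bool" where
  "unmatched_within m S \<longleftrightarrow>
    (\<exists>x\<in>S \<inter> cube 1. \<forall>y\<in>S \<inter> cube m. y \<noteq> x \<longrightarrow> \<not> losing S (TwoFrogs x y))"

lemma cube_mono: "m \<le> n \<Longrightarrow> cube m \<subseteq> cube n"
  by (force simp: cube_def)

text \<open>Only the finitely many pairs in \<open>cube m\<close> are quantified over, and rounding
  moves no point into or out of a cube, so agreement on each pair yields agreement of the
  predicates.\<close>

lemma eventually_unmatched_within: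
  fixes L :: "'a::euclidean_space set"
  assumes fin: "\<forall>B. bounded B \<longrightarrow> finite (L \<inter> B)" and iso: "isosceles_free L"
    and trm: "\<And>x y. x \<in> L \<Longrightarrow> y \<in> L \<Longrightarrow> terminating L (TwoFrogs x y)" and "m \<ge> 1"
  shows "\<forall>\<^sub>F N in sequentially. unmatched_within m (grid.approx L N) \<longleftrightarrow> unmatched_within m L"
proof -
  let ?F = "L \<inter> cube m" and ?L = "grid.approx L"
  have finF: "finite ?F" using fin bounded_cube by blast
  have "\<forall>\<^sub>F N in sequentially. \<forall>x\<in>?F. \<forall>y\<in>?F.
      losing (?L N) (TwoFrogs (grid_point N x) (grid_point N y)) \<longleftrightarrow> losing L (TwoFrogs x y)"
    using finF grid.eventually_losing[OF fin iso] trm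
    by (auto simp: eventually_ball_finite_distrib)
  with eventually_inj_on_grid_point[OF finF] eventually_ge_at_top[of m]
  show ?thesis
  proof eventually_elim
    case (elim N)
    let ?g = "grid_point N"
    have m: "?L N \<inter> cube m = ?g ` ?F"
      using cube_mono[OF elim(2), where 'a = 'a] by (auto simp: grid.approx_def)
    have one: "?L N \<inter> cube 1 = ?g ` (L \<inter> cube 1)"
      using cube_mono[of 1 N, where 'a = 'a] elim(2) \<open>m \<ge> 1\<close> by (auto simp: grid.approx_def)
    have sub: "L \<inter> cube 1 \<subseteq> ?F" using cube_mono[OF \<open>m \<ge> 1\<close>, where 'a = 'a] by blast
    have "unmatched_within m (?L N) \<longleftrightarrow>
        (\<exists>x\<in>L \<inter> cube 1. \<forall>y\<in>?F. ?g y \<noteq> ?g x \<longrightarrow> \<not> losing (?L N) (TwoFrogs (?g x) (?g y)))"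
      unfolding unmatched_within_def m one by simp
    also have "\<dots> \<longleftrightarrow> unmatched_within m L"
      unfolding unmatched_within_def
    proof (intro bex_cong ball_cong refl)
      fix x y assume "x \<in> L \<inter> cube 1" "y \<in> ?F"
      then have "x \<in> ?F" "y \<in> ?F" using sub by auto
      then show "(?g y \<noteq> ?g x \<longrightarrow> \<not> losing (?L N) (TwoFrogs (?g x) (?g y))) \<longleftrightarrow>
          (y \<noteq> x \<longrightarrow> \<not> losing L (TwoFrogs x y))"
        using elim(1,3) by (auto simp: inj_on_eq_iff)
    qed
    finally show ?case .
  qed
qed

text \<open>
  Two points without a partner would have to be far apart: the first player to move from the
  position they form could move to a losing position, which pairs one of them with a closer point.
\<close>

lemma not_both_unmatched:
  fixes L :: "'a::euclidean_space set" and e :: 'a and i j J :: nat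
  assumes trm: "\<And>x y. x \<in> L \<Longrightarrow> y \<in> L \<Longrightarrow> terminating L (TwoFrogs x y)"
    and e: "e \<in> Basis" and ij: "i < j" "j < J"
    and m: "m = 3 * DIM('a) + 2 * J + 1"
    and "unmatched_within m ((+) (- (2 * real i) *\<^sub>R e) ` L)"
    and "unmatched_within m ((+) (- (2 * real j) *\<^sub>R e) ` L)"
  shows False
proof -
  have ex: "\<exists>x\<in>L. - v + x \<in> cube 1 \<and> (\<forall>y\<in>L. - v + y \<in> cube m \<longrightarrow> y \<noteq> x \<longrightarrow> \<not> losing L (TwoFrogs x y))"
    if unm: "unmatched_within m ((+) (- v) ` L)" for v
  proof -
    obtain x where x: "x \<in> L" "- v + x \<in> cube 1"
      "\<And>y. y \<in> L \<Longrightarrow> - v + y \<in> cube m \<Longrightarrow> y \<noteq> x \<Longrightarrow>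
        \<not> losing ((+) (- v) ` L) (TwoFrogs (- v + x) (- v + y))"
      using unm unfolding unmatched_within_def by fastforce
    have "\<not> losing L (TwoFrogs x y)" if "y \<in> L" "- v + y \<in> cube m" "y \<noteq> x" for y
    proof
      assume "losing L (TwoFrogs x y)"
      then have "losing ((+) (- v) ` L) (map_position ((+) (- v)) (TwoFrogs x y))"
        by (rule losing_isometry) (simp add: dist_norm)
      then show False using x(3)[OF that] by simp
    qed
    then show ?thesis using x(1,2) by blast
  qed
  let ?v = "\<lambda>k. (2 * real k) *\<^sub>R e"
  obtain x where x: "x \<in> L" "- ?v i + x \<in> cube 1"
    "\<And>y. y \<in> L \<Longrightarrow> - ?v i + y \<in> cube m \<Longrightarrow> y \<noteq> x \<Longrightarrow> \<not> losing L (TwoFrogs x y)"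
    using ex[of "?v i"] assms(6) by auto
  obtain x' where x': "x' \<in> L" "- ?v j + x' \<in> cube 1"
    "\<And>y. y \<in> L \<Longrightarrow> - ?v j + y \<in> cube m \<Longrightarrow> y \<noteq> x' \<Longrightarrow> \<not> losing L (TwoFrogs x' y)"
    using ex[of "?v j"] assms(7) by auto
  have norm_le: "norm z \<le> DIM('a)" if "z \<in> cube 1" for z :: 'a
  proof -
    have "norm z \<le> (\<Sum>b\<in>Basis. \<bar>z \<bullet> b\<bar>)" by (rule norm_le_l1)
    also have "\<dots> \<le> (\<Sum>b\<in>(Basis::'a set). 1)"
      using that by (intro sum_mono) (auto simp: cube_def abs_le_iff less_imp_le)
    finally show ?thesis by simp
  qed
  note n = norm_le[OF x(2)] norm_le[OF x'(2)]
  have v: "norm (?v j - ?v i) \<le> 2 * J"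
    using e ij by (simp flip: scaleR_left_diff_distrib)
  have r: "dist x x' \<le> 2 * DIM('a) + 2 * J"
  proof -
    have "norm (x - x') = norm ((- ?v i + x) - (- ?v j + x') - (?v j - ?v i))"
      by (rule arg_cong[where f = norm]) simp
    then have "norm (x - x') \<le> norm (- ?v i + x) + norm (- ?v j + x') + norm (?v j - ?v i)"
      using norm_triangle_ineq4[of "(- ?v i + x) - (- ?v j + x')" "?v j - ?v i"]
        norm_triangle_ineq4[of "- ?v i + x" "- ?v j + x'"] by linarith
    then show ?thesis using n v by (simp add: dist_norm)
  qed
  \<comment> \<open>This determines \<open>m\<close>: after translation the unmatched point has norm
    at most \<open>DIM('a)\<close>, and a partner no farther than \<open>dist x x'\<close> adds at
    most \<open>2 * DIM('a) + 2 * J\<close>.\<close>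
  have near: "- w + z \<in> cube m" if "- w + u \<in> cube 1" "dist z u \<le> dist x x'" for w z u :: 'a
  proof (rule mem_cube_if_norm_less)
    have "- w + z = (- w + u) + (z - u)" by simp
    then have "norm (- w + z) \<le> norm (- w + u) + dist z u" by (metis dist_norm norm_triangle_ineq)
    then show "norm (- w + z) < real m" using norm_le[OF that(1)] that(2) r by (simp add: m)
  qed
  \<comment> \<open>The two cubes are half-open of side 2 and offset by at least 2 along
    \<open>e\<close>.\<close>
  have "x \<noteq> x'"
  proof
    assume "x = x'"
    have "(- ?v i + x) \<bullet> e < 1" "- 1 \<le> (- ?v j + x') \<bullet> e" using x(2) x'(2) e by (auto simp: cube_def)
    then have "real j < real i + 1" using e \<open>x = x'\<close> by (simp add: inner_diff_left)
    then show False using ij by simp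
  qed
  from closer_partner[OF trm[OF x(1) x'(1)]] show False
  proof (elim disjE bexE)
    assume "losing L (TwoFrogs x x')"
    then show False using x(3)[OF x'(1) near[OF x(2)]] \<open>x \<noteq> x'\<close> by (simp add: dist_commute)
  next
    fix z assume z: "z \<in> closer L x x'" "losing L (TwoFrogs x z)"
    then show False using x(3)[OF _ near[OF x(2)], of z] by (auto simp: closer_def dist_commute)
  next
    fix z assume z: "z \<in> closer L x' x" "losing L (TwoFrogs x' z)"
    then show False using x'(3)[OF _ near[OF x'(2)], of z] by (auto simp: closer_def)
  qed
qed

section \<open>Translation invariance\<close>

text \<open>A formula in the intensity alone, without reference to a process. Processes of equal
  intensity, in particular translates, thus share it by definition.\<close>

definition observed_law :: "real \<Rightarrow> nat \<Rightarrow> ('a::euclidean_space set \<Rightarrow> bool) \<Rightarrow> real" where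
  "observed_law c N \<Phi> = (\<Sum>S\<in>{S \<in> Pow (grid N \<inter> cube N). \<Phi> S}. \<Prod>g\<in>grid N \<inter> cube N.
    if g \<in> S then 1 - exp (- cell_mean TYPE('a) c N) else exp (- cell_mean TYPE('a) c N))"

lemma translation_borel:
  fixes v :: "'a::euclidean_space"
  assumes "B \<in> sets borel"
  shows "(+) v ` B \<in> sets borel"
proof -
  have "(+) v ` B = (\<lambda>x. x - v) -` B" by (auto simp: image_iff algebra_simps) (metis diff_add_cancel)
  moreover have "(\<lambda>x. x - v) -` B \<inter> space borel \<in> sets borel"
    using assms by (intro measurable_sets) auto
  ultimately show ?thesis by simp
qed

context homogeneous_poisson_process
begin

lemma AE_terminating:
  assumes pos: "intensity > 0"
  shows "AE \<omega> in M. \<forall>x\<in>L \<omega>. \<forall>y\<in>L \<omega>. terminating (L \<omega>) (TwoFrogs x y)"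
proof -
  let ?V = "ball_volume TYPE('a)"
  let ?I = "{(a, b) \<in> \<rat> \<times> \<rat>. a \<le> b \<and> b \<ge> 0 \<and> intensity * (?V b - ?V a) < 1}"
  have "countable ?I"
    by (rule countable_subset[of _ "\<rat> \<times> \<rat>"]) (auto intro: countable_rat)
  then have "AE \<omega> in M. \<forall>p\<in>?I. \<forall>x\<in>L \<omega>. bounded {y. (edge_in (L \<omega>) (fst p) (snd p))\<^sup>*\<^sup>* x y}"
    using AE_bounded_components[OF pos] by (subst AE_ball_countable) auto
  with locally_finite show ?thesis
  proof eventually_elim
    case (elim \<omega>)
    have "terminating (L \<omega>) (TwoFrogs x y)" if "x \<in> L \<omega>" "y \<in> L \<omega>" for x y
      using elim(1) _ _ that
    proof (rule terminating_if_bounded_components)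
      show "0 \<le> intensity" using pos by simp
      show "bounded {y. (edge_in (L \<omega>) a b)\<^sup>*\<^sup>* x y}" if "a \<in> \<rat>" "b \<in> \<rat>" "a \<le> b" "0 \<le> b"
        "intensity * (?V b - ?V a) < 1" "x \<in> L \<omega>" for a b x
        using elim(2)[rule_format, of "(a, b)" x] that by simp
    qed
    then show ?case by blast
  qed
qed

definition observed :: "nat \<Rightarrow> 'w \<Rightarrow> 'a set" where
  "observed N \<omega> = {g \<in> grid N \<inter> cube N. occupied N \<omega> g}"

lemma observed_eq_approx:
  assumes "\<forall>B. bounded B \<longrightarrow> finite (L \<omega> \<inter> B)"
  shows "observed N \<omega> = grid.approx (L \<omega>) N"
proof (intro equalityI subsetI)
  fix g assume g: "g \<in> observed N \<omega>"
  then have "L \<omega> \<inter> cell N g \<noteq> {}" by (auto simp: observed_def occupied_def)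
  then obtain x where "x \<in> L \<omega> \<inter> cell N g" by blast
  then have x: "x \<in> L \<omega>" "g = grid_point N x" by (simp_all add: mem_cell)
  moreover have "x \<in> cube N" using g x(2) by (simp add: observed_def)
  ultimately show "g \<in> grid.approx (L \<omega>) N" by (auto simp: grid.approx_def)
next
  fix g assume "g \<in> grid.approx (L \<omega>) N"
  then show "g \<in> observed N \<omega>"
    using occupied_grid_point[OF assms] by (auto simp: grid.approx_def observed_def)
qed

text \<open>\<open>observed N\<close> takes finitely many values, so any predicate on it is a finite
  disjoint union of occupation patterns.\<close>

lemma prob_observed:
  "{\<omega> \<in> space M. \<Phi> (observed N \<omega>)} \<in> events"
  "prob {\<omega> \<in> space M. \<Phi> (observed N \<omega>)} = observed_law intensity N \<Phi>"
proof -
  let ?J = "grid N \<inter> cube N :: 'a set"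
  let ?I = "{S \<in> Pow ?J. \<Phi> S}"
  let ?E = "\<lambda>S. {\<omega> \<in> space M. \<forall>g\<in>?J. occupied N \<omega> g = (g \<in> S)}"
  have J: "finite ?J" by (rule card_grid_cube_le)
  have I: "finite ?I" by (rule finite_subset[of _ "Pow ?J"]) (use J in \<open>simp_all only: finite_Pow_iff Collect_restrict\<close>)
  have "{\<omega> \<in> space M. occupied N \<omega> g = b} \<in> events" if "g \<in> ?J" for g b
    using occupied_events[of g N] that sets.sets_Collect_neg[of M "\<lambda>\<omega>. occupied N \<omega> g"]
    by (cases b) auto
  then have E: "?E S \<in> events" for S
    using J by (intro sets.sets_Collect_finite_All)
  have eq: "{\<omega> \<in> space M. \<Phi> (observed N \<omega>)} = (\<Union>S\<in>?I. ?E S)"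
  proof -
    have E_iff: "\<omega> \<in> ?E S \<longleftrightarrow> \<omega> \<in> space M \<and> observed N \<omega> = S" if "S \<subseteq> ?J" for \<omega> S
      using that unfolding observed_def by blast
    have sub: "observed N \<omega> \<subseteq> ?J" for \<omega> by (auto simp: observed_def)
    show ?thesis
    proof (intro equalityI subsetI)
      fix \<omega> assume \<omega>: "\<omega> \<in> {\<omega> \<in> space M. \<Phi> (observed N \<omega>)}"
      then have "\<omega> \<in> ?E (observed N \<omega>)" using E_iff[OF sub] by simp
      moreover have "observed N \<omega> \<in> ?I" using \<omega> sub by simp
      ultimately show "\<omega> \<in> (\<Union>S\<in>?I. ?E S)" by (rule UN_I[rotated])
    next
      fix \<omega> assume "\<omega> \<in> (\<Union>S\<in>?I. ?E S)"
      then obtain S where S: "S \<in> ?I" "\<omega> \<in> ?E S" by (rule UN_E)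
      then have "S \<subseteq> ?J" "\<Phi> S" by simp_all
      from iffD1[OF E_iff[OF this(1)] S(2)] \<open>\<Phi> S\<close>
      show "\<omega> \<in> {\<omega> \<in> space M. \<Phi> (observed N \<omega>)}" by simp
    qed
  qed
  show "{\<omega> \<in> space M. \<Phi> (observed N \<omega>)} \<in> events"
    unfolding eq using I E by (rule sets.finite_UN)
  have "prob (\<Union>S\<in>?I. ?E S) = (\<Sum>S\<in>?I. prob (?E S))"
  proof (rule finite_measure_finite_Union[OF I])
    show "disjoint_family_on ?E ?I" by (fastforce simp: disjoint_family_on_def)
  qed (use E in blast)
  also have "\<dots> = observed_law intensity N \<Phi>"
    unfolding observed_law_def using J by (intro sum.cong refl prob_occupied_pattern) auto
  finally show "prob {\<omega> \<in> space M. \<Phi> (observed N \<omega>)} = observed_law intensity N \<Phi>"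
    unfolding eq .
qed

text \<open>The limit inferior of the observed events is a measurable version of being unmatched,
  and its probability is a limit determined by the intensity.\<close>

lemma observed_law_tendsto:
  assumes pos: "intensity > 0" and "m \<ge> 1"
  obtains A where "A \<in> events" "AE \<omega> in M. \<omega> \<in> A \<longleftrightarrow> unmatched_within m (L \<omega>)"
    "(\<lambda>N. observed_law intensity N (unmatched_within m :: 'a set \<Rightarrow> bool)) \<longlonglongrightarrow> prob A"
proof -
  define U where "U N = {\<omega> \<in> space M. unmatched_within m (observed N \<omega>)}" for N
  define A where "A = (\<Union>n. \<Inter>N\<in>{n..}. U N)"
  have U: "U N \<in> events" for N unfolding U_def by (rule prob_observed)
  then have A: "A \<in> events" unfolding A_def
    by (intro sets.countable_UN' sets.countable_INT') auto
  have ev: "AE \<omega> in M. \<forall>\<^sub>F N in sequentially. \<omega> \<in> U N \<longleftrightarrow> unmatched_within m (L \<omega>)"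
    using locally_finite AE_isosceles_free[OF pos] AE_terminating[OF pos] AE_space
  proof eventually_elim
    case (elim \<omega>)
    have "\<forall>\<^sub>F N in sequentially. unmatched_within m (grid.approx (L \<omega>) N) \<longleftrightarrow> unmatched_within m (L \<omega>)"
      using elim \<open>m \<ge> 1\<close> by (intro eventually_unmatched_within) auto
    then show ?case using elim by (simp add: U_def observed_eq_approx)
  qed
  have mem: "AE \<omega> in M. \<omega> \<in> A \<longleftrightarrow> unmatched_within m (L \<omega>)"
    using ev
  proof eventually_elim
    case (elim \<omega>)
    then obtain k where k: "\<And>N. N \<ge> k \<Longrightarrow> \<omega> \<in> U N \<longleftrightarrow> unmatched_within m (L \<omega>)"
      by (auto simp: eventually_sequentially)
    show ?case
    proof
      assume "\<omega> \<in> A"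
      then obtain n where "\<And>N. N \<ge> n \<Longrightarrow> \<omega> \<in> U N" by (auto simp: A_def)
      then show "unmatched_within m (L \<omega>)" using k[of "max n k"] by simp
    qed (use k in \<open>auto simp: A_def\<close>)
  qed
  have "(\<lambda>N. \<integral>\<omega>. indicator (U N) \<omega> \<partial>M) \<longlonglongrightarrow> (\<integral>\<omega>. indicator A \<omega> \<partial>M :: real)"
  proof (rule integral_dominated_convergence[where w = "\<lambda>_. 1"])
    show "AE \<omega> in M. (\<lambda>N. indicator (U N) \<omega> :: real) \<longlonglongrightarrow> indicator A \<omega>"
      using ev mem
    proof eventually_elim
      case (elim \<omega>)
      from elim(1) have "\<forall>\<^sub>F N in sequentially. (indicator (U N) \<omega> :: real) = indicator A \<omega>"
        by eventually_elim (use elim(2) in \<open>simp add: indicator_def\<close>)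
      then show ?case by (rule tendsto_eventually)
    qed
  qed (use U A in \<open>auto simp: indicator_def\<close>)
  then have "(\<lambda>N. prob (U N)) \<longlonglongrightarrow> prob A" using U A by (simp add: emeasure_eq_measure)
  then show ?thesis using that A mem by (simp add: U_def prob_observed(2))
qed

text \<open>Shifting the points amounts to shifting the test sets back, and volume is translation
  invariant.\<close>

lemma translated:
  "homogeneous_poisson_process M (\<lambda>\<omega>. (+) v ` L \<omega>) intensity"
proof -
  have int: "(+) v ` L \<omega> \<inter> B = (+) v ` (L \<omega> \<inter> (+) (- v) ` B)" for \<omega> B
    by (force simp: image_iff)
  have card: "card ((+) v ` L \<omega> \<inter> B) = card (L \<omega> \<inter> (+) (- v) ` B)" for \<omega> B
    unfolding int by (simp add: card_image)
  have bdd: "bounded ((+) (- v) ` B)" if "bounded B" for B using that by (rule bounded_translation)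
  have vol: "measure lborel ((+) (- v) ` B) = measure lborel B" if "B \<in> sets borel" for B
  proof -
    have "measure lebesgue S = measure lborel S" if "S \<in> sets borel" for S :: "'a set"
      using that by (simp add: measure_completion)
    from this[OF that] this[OF translation_borel[OF that]] show ?thesis
      using measure_translation[of "- v" B] by metis
  qed
  show ?thesis
  proof
    show "AE \<omega> in M. \<forall>B. bounded B \<longrightarrow> finite ((+) v ` L \<omega> \<inter> B)"
      unfolding int using locally_finite by eventually_elim (blast intro: bdd finite_imageI)
    show "random_variable (count_space UNIV) (\<lambda>\<omega>. card ((+) v ` L \<omega> \<inter> B))"
      if "B \<in> sets borel" "bounded B" for B
      unfolding card using that by (intro count_measurable translation_borel bdd)
    show "prob {\<omega> \<in> space M. card ((+) v ` L \<omega> \<inter> B) = k} =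
        (intensity * measure lborel B) ^ k / fact k * exp (- (intensity * measure lborel B))"
      if "B \<in> sets borel" "bounded B" for B k
      unfolding card count_poisson[OF translation_borel[OF that(1)] bdd[OF that(2)]] vol[OF that(1)] ..
    show "indep_vars (\<lambda>_. count_space UNIV) (\<lambda>i \<omega>. card ((+) v ` L \<omega> \<inter> B i)) I"
      if "finite I" "disjoint_family_on B I" "\<And>i. i \<in> I \<Longrightarrow> B i \<in> sets borel \<and> bounded (B i)"
      for B :: "nat \<Rightarrow> 'a set" and I
      unfolding card
    proof (rule count_indep[OF that(1)])
      show "disjoint_family_on (\<lambda>i. (+) (- v) ` B i) I"
        unfolding disjoint_family_on_def
      proof (intro ballI impI)
        fix i j assume "i \<in> I" "j \<in> I" "i \<noteq> j"
        then have "B i \<inter> B j = {}" using that(2) by (simp add: disjoint_family_on_def)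
        then show "(+) (- v) ` B i \<inter> (+) (- v) ` B j = {}"
          using image_Int[of "(+) (- v)" "B i" "B j"] by simp
      qed
    qed (use that(3) translation_borel bdd in blast)
  qed
qed

lemma AE_matched_in_cube:
  assumes pos: "intensity > 0"
  shows "AE \<omega> in M. \<forall>x\<in>L \<omega> \<inter> cube 1. \<exists>y\<in>L \<omega>. y \<noteq> x \<and> losing (L \<omega>) (TwoFrogs x y)"
proof -
  have "AE \<omega> in M. \<not> (\<exists>x\<in>L \<omega> \<inter> cube 1. \<forall>y\<in>L \<omega>. y \<noteq> x \<longrightarrow> \<not> losing (L \<omega>) (TwoFrogs x y))"
  proof (rule AE_not_if_eventually_in_small_events)
    fix \<epsilon> :: real assume "\<epsilon> > 0"
    then obtain k where k: "1 / real (Suc k) < \<epsilon>" using nat_approx_posE by metis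
    define J where "J = Suc k"
    define m where "m = 3 * DIM('a) + 2 * J + 1"
    obtain e :: 'a where e: "e \<in> Basis" using nonempty_Basis by blast
    define T where "T j \<omega> = (+) (- (2 * real j) *\<^sub>R e) ` L \<omega>" for j \<omega>
    have T: "homogeneous_poisson_process M (T j) intensity" for j
      unfolding T_def by (rule translated)
    have "\<exists>A\<in>events. (AE \<omega> in M. \<omega> \<in> A \<longleftrightarrow> unmatched_within m (T j \<omega>)) \<and>
        (\<lambda>N. observed_law intensity N (unmatched_within m :: 'a set \<Rightarrow> bool)) \<longlonglongrightarrow> prob A" for j
      using homogeneous_poisson_process.observed_law_tendsto[OF T[of j] pos, of m] by (auto simp: m_def)
    then obtain A where A: "\<And>j. A j \<in> events"
      "\<And>j. AE \<omega> in M. \<omega> \<in> A j \<longleftrightarrow> unmatched_within m (T j \<omega>)"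
      "\<And>j. (\<lambda>N. observed_law intensity N (unmatched_within m :: 'a set \<Rightarrow> bool)) \<longlonglongrightarrow> prob (A j)"
      by metis
    \<comment> \<open>Both are limits of the same sequence, as the observed law does not see the
      translation.\<close>
    have eq: "prob (A j) = prob (A 0)" for j using A(3) LIMSEQ_unique by blast
    have disj: "AE \<omega> in M. \<omega> \<notin> A i \<or> \<omega> \<notin> A j" if "i < j" "j < J" for i j
      using AE_terminating[OF pos] A(2)[of i] A(2)[of j]
    proof eventually_elim
      case (elim \<omega>)
      then show ?case
        using not_both_unmatched[of "L \<omega>" e i j J m] e that by (auto simp: T_def m_def)
    qed
    have "pairwise (\<lambda>i j. AE \<omega> in M. \<omega> \<notin> A i \<or> \<omega> \<notin> A j) {..<J}"
    proof (rule pairwiseI)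
      fix i j assume "i \<in> {..<J}" "j \<in> {..<J}" "i \<noteq> j"
      then consider "i < j" "j < J" | "j < i" "i < J" by fastforce
      then show "AE \<omega> in M. \<omega> \<notin> A i \<or> \<omega> \<notin> A j"
        using disj[of i j] disj[of j i] by cases (auto simp: disj_commute)
    qed
    \<comment> \<open>Pairwise overlaps are null sets, so the probabilities still add up.\<close>
    then have "(\<Sum>j<J. prob (A j)) = prob (\<Union>j<J. A j)"
      using A(1) by (intro measure_UNION_AE[symmetric]) (auto simp: fmeasurable_eq_sets)
    moreover have "(\<Sum>j<J. prob (A j)) = (\<Sum>j<J. prob (A 0))" by (intro sum.cong refl eq)
    ultimately have "real J * prob (A 0) \<le> 1" using prob_le_1[of "\<Union>j<J. A j"] by simp
    then have "prob (A 0) \<le> 1 / real (Suc k)" by (simp add: J_def field_simps)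
    then have small: "prob (A 0) \<le> \<epsilon>" using k by simp
    have "AE \<omega> in M. (\<exists>x\<in>L \<omega> \<inter> cube 1. \<forall>y\<in>L \<omega>. y \<noteq> x \<longrightarrow> \<not> losing (L \<omega>) (TwoFrogs x y)) \<longrightarrow> \<omega> \<in> A 0"
      using A(2)[of 0] by eventually_elim (auto simp: T_def unmatched_within_def)
    then show "\<exists>U. (\<forall>N. U N \<in> events) \<and>
        (AE \<omega> in M. (\<exists>x\<in>L \<omega> \<inter> cube 1. \<forall>y\<in>L \<omega>. y \<noteq> x \<longrightarrow> \<not> losing (L \<omega>) (TwoFrogs x y)) \<longrightarrow>
          (\<forall>\<^sub>F N in sequentially. \<omega> \<in> U N)) \<and>
        (\<forall>\<^sub>F N in sequentially. prob (U N) \<le> \<epsilon>)"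
      using A(1) small by (intro exI[of _ "\<lambda>_. A 0"]) simp
  qed
  then show ?thesis by eventually_elim blast
qed

lemma AE_matched:
  assumes pos: "intensity > 0"
  shows "AE \<omega> in M. \<forall>x\<in>L \<omega>. \<exists>y\<in>L \<omega>. y \<noteq> x \<and> losing (L \<omega>) (TwoFrogs x y)"
proof -
  have "countable (grid 0 :: 'a set)"
  proof -
    have "x \<in> (\<Union>m. cube m)" for x :: 'a
      by (rule three_points_in_cube[of x x x]) blast
    then have eq: "grid 0 = (\<Union>m. grid 0 \<inter> cube m :: 'a set)" by blast
    show ?thesis
      by (subst eq) (intro countable_UN countable_finite card_grid_cube_le countableI_type)
  qed
  then have "AE \<omega> in M. \<forall>v\<in>grid 0. \<forall>x\<in>(+) (- v) ` L \<omega> \<inter> cube 1.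
      \<exists>y\<in>(+) (- v) ` L \<omega>. y \<noteq> x \<and> losing ((+) (- v) ` L \<omega>) (TwoFrogs x y)"
    using homogeneous_poisson_process.AE_matched_in_cube[OF translated pos]
    by (subst AE_ball_countable) (assumption, rule ballI)
  then show ?thesis
  proof eventually_elim
    case (elim \<omega>)
    show ?case
    proof
      fix x assume x: "x \<in> L \<omega>"
      define v where "v = grid_point 0 x"
      have "- v + x \<in> cube 1"
        unfolding cube_def
      proof (intro CollectI ballI)
        fix b :: 'a assume "b \<in> Basis"
        from grid_point_bounds[OF this, where N = 0 and x = x]
        show "- real 1 \<le> (- v + x) \<bullet> b \<and> (- v + x) \<bullet> b < real 1"
          by (simp add: v_def inner_diff_left)
      qed
      then have vx: "- v + x \<in> (+) (- v) ` L \<omega> \<inter> cube 1" using x by (rule IntI[OF imageI, rotated])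
      have v: "v \<in> grid 0" by (simp add: v_def)
      obtain w where w: "w \<in> (+) (- v) ` L \<omega>" "w \<noteq> - v + x"
        "losing ((+) (- v) ` L \<omega>) (TwoFrogs (- v + x) w)"
        using elim[rule_format, OF v vx] by (elim bexE conjE)
      then obtain y where y: "y \<in> L \<omega>" "w = - v + y" by (elim imageE)
      have "losing ((+) v ` (+) (- v) ` L \<omega>) (map_position ((+) v) (TwoFrogs (- v + x) w))"
        using w(3) by (rule losing_isometry) (simp add: dist_norm)
      then have "losing (L \<omega>) (TwoFrogs x y)" by (simp add: image_image y(2))
      moreover have "y \<noteq> x" using w(2) y(2) by simp
      ultimately show "\<exists>y\<in>L \<omega>. y \<noteq> x \<and> losing (L \<omega>) (TwoFrogs x y)" using y(1) by blast
    qed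
  qed
qed

theorem AE_friendly_frogs_win_Bob:
  assumes "intensity > 0"
  shows "AE \<omega> in M. friendly_frogs_win (L \<omega>) Bob"
  using AE_matched[OF assms] AE_terminating[OF assms]
  by eventually_elim (auto intro!: friendly_frogs_win_Bob losing_NoFrogs terminating_NoFrogs)

end

theorem theorem4:
  fixes M :: "'w measure"
    and L :: "'w \<Rightarrow> (real ^ 'd) set"
    and intensity :: real
  assumes "intensity > 0"
    and "homogeneous_poisson_process M L intensity"
  shows "AE \<omega> in M. friendly_frogs_win (L \<omega>) Bob"
  using assms by (rule homogeneous_poisson_process.AE_friendly_frogs_win_Bob[rotated])

end
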